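(* Let $p$ be a prime, $n \in \mathbb{N}$ (positive integers), $G = C_p \oplus C_{pn}$, and let $K$ be a splitting field of $G$. \begin{enumerate} \item If $p \le 3$, then $\mathsf d(G) = \mathsf d(G,K)$. \item If $p \ge 5$ and $n \ge 2$, then $\mathsf d(G) < \mathsf d(G,K)$. \end{enumerate}
   Context: $C_k$ denotes a cyclic group of order $k$; groups are written additively. A sequence over a finite abelian group $G$ is a finite unordered list $S = g_1 \cdot \ldots \cdot g_l$ of elements of $G$ (an element of the free abelian monoid on $G$); $|S| = l$ is its length. $S$ is zero-sum free if $\sum_{i \in I} g_i \ne 0$ for every nonempty $I \subset \{1,\dots,l\}$. $\mathsf d(G)$ is the maximal length of a zero-sum free sequence over $G$ (so $\mathsf d(G)+1$ is the Davenport constant). For a commutative ring $R$ (with $1 \neq 0$), $R[G]$ is the group algebra, free $R$-module with basis $\{X^g : g \in G\}$ and $X^gX^h = X^{g+h}$; $\mathsf d(G,R) \in \mathbb N \cup\{\infty\}$ is the supremum of all $l \in \mathbb N$ for which there exists a sequence $g_1 \cdot\ldots\cdot g_l$ over $G$ with $(X^{g_1}-a_1)\cdots(X^{g_l}-a_l) \ne 0$ in $R[G]$ for all $a_1,\dots,a_l \in R\setminus\{0\}$. A field $K$ is a splitting field of $G$ if the group of $\exp(G)$-th roots of unity in $K$ has exactly $\exp(G)$ elements. *)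

theory Defs
  imports
    "HOL-Algebra.Elementary_Groups"
    "HOL-Library.Extended_Nat"
    "HOL-Library.Poly_Mapping"
    "HOL-Computational_Algebra.Primes"
begin

text \<open>
  Finite abelian groups are types of class \<open>{finite, ab_group_add}\<close>. Constants that depend only on
  the group or on the coefficient ring take these as \<open>itself\<close> arguments. A sequence over a group is
  given by an enumeration \<open>gs\<close> of its terms; the properties of sequences defined below do not depend
  on the order of the terms.
\<close>

text \<open>Lets the group underlying a type be compared with groups of HOL-Algebra.\<close>

definition additive_group :: "'g::ab_group_add itself \<Rightarrow> 'g monoid" where
  "additive_group _ = \<lparr>carrier = UNIV, monoid.mult = (+), one = 0\<rparr>"

definition group_exponent :: "'g::{finite,ab_group_add} itself \<Rightarrow> nat" where
  "group_exponent _ = (LEAST m. m > 0 \<and> (\<forall>g::'g. (\<Sum>i<m. g) = 0))"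

definition splitting_field :: "'g::{finite,ab_group_add} itself \<Rightarrow> 'k::field itself \<Rightarrow> bool" where
  "splitting_field G _ \<longleftrightarrow> card {x::'k. x ^ group_exponent G = 1} = group_exponent G"

definition zero_sum_free :: "'g::ab_group_add list \<Rightarrow> bool" where
  "zero_sum_free gs \<longleftrightarrow> (\<forall>I \<subseteq> {..<length gs}. I \<noteq> {} \<longrightarrow> (\<Sum>i\<in>I. gs ! i) \<noteq> 0)"

definition small_davenport :: "'g::{finite,ab_group_add} itself \<Rightarrow> nat" where
  "small_davenport _ = Max {length gs | gs :: 'g list. zero_sum_free gs}"

text \<open>
  The group algebra $R[G]$ is the type \<open>'g \<Rightarrow>\<^sub>0 'r\<close> of finitely supported functions, on which
  multiplication is convolution. The basis element $X^g$ is \<open>Poly_Mapping.single g 1\<close>, and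
  \<open>Poly_Mapping.single 0 a\<close> is the scalar $a$.
\<close>

definition davenport_over ::
    "'g::{finite,ab_group_add} itself \<Rightarrow> 'r::comm_ring_1 itself \<Rightarrow> enat" where
  "davenport_over _ _ = Sup {enat (length gs) | gs :: 'g list.
     \<forall>a :: nat \<Rightarrow> 'r. (\<forall>i<length gs. a i \<noteq> 0) \<longrightarrow>
       (\<Prod>i<length gs. Poly_Mapping.single (gs ! i) 1 - Poly_Mapping.single 0 (a i)) \<noteq> 0}"

text \<open>The maximum in \<open>small_davenport\<close> is taken over a finite nonempty set.\<close>

lemma zero_sum_free_length_less:
  fixes gs :: "'g::{finite,ab_group_add} list"
  assumes "zero_sum_free gs"
  shows "length gs < card (UNIV :: 'g set)"
proof -
  define s where "s k = (\<Sum>i<k. gs ! i)" for k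
  have ne: "s k \<noteq> s l" if "k < l" "l \<le> length gs" for k l
  proof -
    have "s l = s k + (\<Sum>i\<in>{k..<l}. gs ! i)"
      using that unfolding s_def lessThan_atLeast0
      by (simp add: sum.atLeastLessThan_concat)
    moreover have "(\<Sum>i\<in>{k..<l}. gs ! i) \<noteq> 0"
      using assms[unfolded zero_sum_free_def, rule_format, of "{k..<l}"] that
      by (simp add: subset_eq)
    ultimately show ?thesis by simp
  qed
  have "inj_on s {..length gs}"
  proof (rule inj_onI)
    fix k l
    assume "k \<in> {..length gs}" "l \<in> {..length gs}" "s k = s l"
    then show "k = l"
      using ne[of k l] ne[of l k] by (cases k l rule: linorder_cases) auto
  qed
  then have "card {..length gs} \<le> card (UNIV :: 'g set)"
    by (intro card_inj_on_le[where f = s]) auto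
  then show ?thesis by simp
qed

lemma finite_zero_sum_free_lengths:
  "finite {length gs | gs :: 'g::{finite,ab_group_add} list. zero_sum_free gs}"
  by (rule finite_subset[of _ "{..<card (UNIV :: 'g set)}"]) (auto dest: zero_sum_free_length_less)

lemma zero_sum_free_Nil: "zero_sum_free []"
  by (simp add: zero_sum_free_def)

end

theory Submission
  imports Defs
    "HOL-Computational_Algebra.Polynomial"
    "HOL-Library.Disjoint_Sets"
    "HOL-Number_Theory.Number_Theory"
begin

text \<open>
  Since \<open>K\<close> contains a primitive root of unity \<open>z\<close> of order \<open>p n\<close>, an element of \<open>K[G]\<close> vanishes iff
  all characters of \<open>G\<close> vanish on it. So $\prod_i (X^{g_i} - a_i) = 0$ iff every character \<open>\<chi>\<close>
  satisfies $\chi(g_i) = a_i$ for some \<open>i\<close>. In coordinates \<open>(c, d)\<close> on \<open>G\<close> the characters are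
  $z^{n x c + y d}$ with \<open>x < p\<close> and \<open>y < p n\<close>. Writing \<open>y = k + n y'\<close> with \<open>k < n\<close> splits them into \<open>n\<close> affine
  planes with coordinates \<open>x, y'\<close> modulo \<open>p\<close>. When the coordinate \<open>d\<close> of \<open>g\<^sub>i\<close> is a unit modulo \<open>p n\<close>, the
  condition $\chi(g_i) = a_i$ describes at most a line in one of these planes, with direction determined
  by \<open>g\<^sub>i\<close>; in general, each \<open>g\<^sub>i\<close> can be made to cover at least a line of such a direction in any
  chosen plane. It remains to decide which families of directions can cover all \<open>n\<close> planes.

  For \<open>p \<le> 3\<close>, any \<open>p n + p - 1\<close> lines suffice: cover planes by full parallel classes as long as
  possible; what remains is covered by hand. For \<open>p \<ge> 5\<close> and \<open>n \<ge> 2\<close>, the directions \<open>0, 1, 2, 3\<close> with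
  multiplicities \<open>(n - 1) p - 1\<close>, \<open>p - 1\<close>, \<open>p - 1\<close>, \<open>2\<close> do not suffice. The upper bound
  \<open>p n + p - 2\<close> for $\mathsf{d}(G)$ is Olson's argument: zero-sum subsequences modulo \<open>p\<close>, of length at most \<open>p\<close> but for
  the last one, are split off until there are \<open>n\<close> of them.
\<close>

section \<open>Zero-sum subsets\<close>

lemma sum_Pow_containing:
  fixes f :: "'a set \<Rightarrow> 'b::comm_monoid_add"
  assumes "finite S" "s \<in> S"
  shows "(\<Sum>I | I \<subseteq> S \<and> s \<in> I. f I) = (\<Sum>I\<in>Pow (S - {s}). f (insert s I))"
  by (rule sum.reindex_bij_witness[of _ "insert s" "\<lambda>I. I - {s}"]) (use assms in \<open>auto simp: insert_absorb\<close>)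

text \<open>Adding or removing a fixed \<open>s\<close> pairs the subsets of \<open>S\<close> with
  opposite signs.\<close>

lemma alternating_sum_Pow:
  assumes "finite S" "S \<noteq> {}"
  shows "(\<Sum>I\<in>Pow S. (-1) ^ card I) = (0::int)"
proof -
  obtain s where s: "s \<in> S" using assms by blast
  have fin: "finite I" if "I \<subseteq> S" for I using that assms finite_subset by blast
  have "(\<Sum>I\<in>Pow S. (-1) ^ card I) = (\<Sum>I\<in>Pow (S - {s}). (-1) ^ card I :: int)
      + (\<Sum>I | I \<subseteq> S \<and> s \<in> I. (-1) ^ card I)"
    by (subst sum.union_disjoint[symmetric]) (use assms in \<open>auto intro!: sum.cong\<close>)
  also have "(\<Sum>I | I \<subseteq> S \<and> s \<in> I. (-1) ^ card I) = (\<Sum>I\<in>Pow (S - {s}). - ((-1) ^ card I) :: int)"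
    unfolding sum_Pow_containing[OF assms(1) s]
  proof (rule sum.cong)
    fix I assume "I \<in> Pow (S - {s})"
    then have "s \<notin> I" "finite I" using fin by auto
    then show "(-1) ^ card (insert s I) = (- ((-1) ^ card I) :: int)" by simp
  qed simp
  finally show ?thesis by (simp add: sum_negf)
qed

text \<open>The \<open>card S\<close>-th mixed difference of a polynomial of smaller degree vanishes.\<close>

lemma alternating_sum_prod_affine:
  fixes w :: "'b \<Rightarrow> int" and c :: "'b \<Rightarrow> 'a \<Rightarrow> int"
  assumes "finite M" "finite S" "card M < card S"
  shows "(\<Sum>I\<in>Pow S. (-1) ^ card I * (\<Prod>m\<in>M. w m + (\<Sum>i\<in>I. c m i))) = 0"
  using assms
proof (induction M arbitrary: S w rule: finite_induct)
  case empty
  then show ?case by (simp add: alternating_sum_Pow card_gt_0_iff)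
next
  case (insert k M)
  let ?P = "\<lambda>w I. \<Prod>m\<in>M. w m + (\<Sum>i\<in>I. c m i)"
  have fin: "finite I" if "I \<subseteq> S" for I using that insert.prems finite_subset by blast
  \<comment> \<open>The factor of \<open>k\<close> is split into its constant, whose part the
    induction hypothesis kills, and its linear terms, which are then summed with \<open>i\<close>
    outermost.\<close>
  have "(\<Sum>I\<in>Pow S. (-1) ^ card I * (\<Prod>m\<in>insert k M. w m + (\<Sum>i\<in>I. c m i))) =
     w k * (\<Sum>I\<in>Pow S. (-1) ^ card I * ?P w I)
      + (\<Sum>I\<in>Pow S. \<Sum>i\<in>I. c k i * ((-1) ^ card I * ?P w I))"
    unfolding sum_distrib_left sum.distrib[symmetric]
    using insert.hyps by (intro sum.cong) (simp_all add: sum_distrib_right[symmetric] algebra_simps)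
  also have "(\<Sum>I\<in>Pow S. (-1) ^ card I * ?P w I) = 0"
    using insert by auto
  also have "(\<Sum>I\<in>Pow S. \<Sum>i\<in>I. c k i * ((-1) ^ card I * ?P w I))
      = (\<Sum>I\<in>Pow S. \<Sum>i\<in>{i \<in> S. i \<in> I}. c k i * ((-1) ^ card I * ?P w I))"
    by (intro sum.cong) auto
  also have "\<dots> = (\<Sum>i\<in>S. \<Sum>I\<in>{I \<in> Pow S. i \<in> I}. c k i * ((-1) ^ card I * ?P w I))"
    by (rule sum.swap_restrict) (use insert.prems in auto)
  also have "\<dots> = (\<Sum>i\<in>S. c k i * (\<Sum>I | I \<subseteq> S \<and> i \<in> I. (-1) ^ card I * ?P w I))"
    by (simp add: sum_distrib_left)
  also have "\<dots> = 0"
  proof (rule sum.neutral, rule ballI)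
    fix i assume i: "i \<in> S"
    \<comment> \<open>Removing \<open>i\<close> from \<open>I\<close> flips the sign and absorbs
      \<open>c m i\<close> into the constants, which is why the induction hypothesis is needed for
      arbitrary \<open>w\<close>.\<close>
    have "(\<Sum>I | I \<subseteq> S \<and> i \<in> I. (-1) ^ card I * ?P w I)
      = (\<Sum>I\<in>Pow (S - {i}). - ((-1) ^ card I * ?P (\<lambda>m. w m + c m i) I))"
      unfolding sum_Pow_containing[OF insert.prems(1) i]
    proof (rule sum.cong)
      fix I assume "I \<in> Pow (S - {i})"
      then have "i \<notin> I" "finite I" using fin by auto
      then show "(-1) ^ card (insert i I) * ?P w (insert i I)
          = - ((-1) ^ card I * ?P (\<lambda>m. w m + c m i) I)" by (simp add: algebra_simps)
    qed simp
    also have "\<dots> = 0"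
      unfolding sum_negf using insert i by (subst insert.IH) (auto simp: card_Diff_singleton)
    finally show "c k i * (\<Sum>I | I \<subseteq> S \<and> i \<in> I. (-1) ^ card I * ?P w I) = 0" by simp
  qed
  finally show ?case by simp
qed

text \<open>Modulo \<open>p\<close>, the product of the $1 - \sigma_k^{p-1}$, where $\sigma_k$ is the sum of \<open>c k\<close>
  over \<open>I\<close>, is the indicator of the \<open>I\<close> that are wanted; its degree is less than \<open>card S\<close>.\<close>

lemma exists_zero_sum_subset:
  fixes c :: "nat \<Rightarrow> 'a \<Rightarrow> nat"
  assumes p: "prime p" and S: "finite S" "r * (p - 1) < card S"
  shows "\<exists>I\<subseteq>S. I \<noteq> {} \<and> (\<forall>k<r. p dvd (\<Sum>i\<in>I. c k i))"
proof (rule ccontr)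
  assume no: "\<not> ?thesis"
  define F :: "'a set \<Rightarrow> int"
    where "F I = (\<Prod>k<r. - (int (\<Sum>i\<in>I. c k i) ^ (p - 1)) + 1)" for I
  have p1: "p - 1 > 0" using prime_gt_1_nat[OF p] by simp
  \<comment> \<open>Expanding over the sets \<open>B\<close> of factors that contribute their power
    leaves products of at most \<open>r * (p - 1)\<close> linear factors. The summand
    \<open>0\<close> fits \<open>alternating_sum_prod_affine\<close>.\<close>
  have "(\<Sum>I\<in>Pow S. (-1) ^ card I * F I) =
      (\<Sum>I\<in>Pow S. \<Sum>B\<in>Pow {..<r}. (-1) ^ card B *
         ((-1) ^ card I * (\<Prod>m\<in>B \<times> {..<p - 1}. 0 + (\<Sum>i\<in>I. int (c (fst m) i)))))"
  proof (rule sum.cong)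
    fix I
    have "F I = (\<Sum>B\<in>Pow {..<r}. \<Prod>k\<in>B. - (int (\<Sum>i\<in>I. c k i) ^ (p - 1)))"
      unfolding F_def by (subst prod_add) auto
    also have "\<dots> = (\<Sum>B\<in>Pow {..<r}. (-1) ^ card B * (\<Prod>m\<in>B \<times> {..<p - 1}. 0 + (\<Sum>i\<in>I. int (c (fst m) i))))"
    proof (rule sum.cong)
      fix B assume "B \<in> Pow {..<r}"
      have "(\<Prod>m\<in>B \<times> {..<p - 1}. 0 + (\<Sum>i\<in>I. int (c (fst m) i)))
          = (\<Prod>k\<in>B. \<Prod>j<p - 1. \<Sum>i\<in>I. int (c k i))"
        by (simp add: prod.cartesian_product split_def del: prod_constant)
      then show "(\<Prod>k\<in>B. - (int (\<Sum>i\<in>I. c k i) ^ (p - 1)))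
        = (-1) ^ card B * (\<Prod>m\<in>B \<times> {..<p - 1}. 0 + (\<Sum>i\<in>I. int (c (fst m) i)))"
        by (simp add: prod_uminus)
    qed simp
    finally show "(-1) ^ card I * F I = (\<Sum>B\<in>Pow {..<r}. (-1) ^ card B *
         ((-1) ^ card I * (\<Prod>m\<in>B \<times> {..<p - 1}. 0 + (\<Sum>i\<in>I. int (c (fst m) i)))))"
      by (simp add: sum_distrib_left mult.left_commute)
  qed simp
  also have "\<dots> = (\<Sum>B\<in>Pow {..<r}. (-1) ^ card B * (\<Sum>I\<in>Pow S.
         (-1) ^ card I * (\<Prod>m\<in>B \<times> {..<p - 1}. 0 + (\<Sum>i\<in>I. int (c (fst m) i)))))"
    by (subst sum.swap) (simp add: sum_distrib_left)
  also have "\<dots> = 0"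
  proof (rule sum.neutral, rule ballI)
    fix B assume "B \<in> Pow {..<r}"
    then have B: "finite B" "card B \<le> r"
      using finite_subset card_mono[of "{..<r}" B] by auto
    have "card B * (p - 1) \<le> r * (p - 1)" using B(2) by (rule mult_right_mono) simp
    then have "card (B \<times> {..<p - 1}) < card S"
      using S(2) by (simp only: card_cartesian_product card_lessThan)
    then show "(-1) ^ card B * (\<Sum>I\<in>Pow S.
         (-1) ^ card I * (\<Prod>m\<in>B \<times> {..<p - 1}. 0 + (\<Sum>i\<in>I. int (c (fst m) i)))) = 0"
      using alternating_sum_prod_affine[of "B \<times> {..<p - 1}" S "\<lambda>_. 0" "\<lambda>m i. int (c (fst m) i)"] B S by simp
  qed
  finally have zero: "(\<Sum>I\<in>Pow S. (-1) ^ card I * F I) = 0" .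
  \<comment> \<open>Under \<open>no\<close>, Fermat's theorem gives every nonempty \<open>I\<close>
    a factor divisible by \<open>p\<close>. Modulo \<open>p\<close> the vanishing sum thus reduces
    to \<open>F {} = 1\<close>.\<close>
  have "int p dvd F I" if "I \<subseteq> S" "I \<noteq> {}" for I
  proof -
    have "\<not> (\<forall>k<r. p dvd (\<Sum>i\<in>I. c k i))" using no that by metis
    then obtain k where k: "k < r" "\<not> p dvd (\<Sum>i\<in>I. c k i)" by blast
    have "[(\<Sum>i\<in>I. c k i) ^ (p - 1) = 1] (mod p)"
      by (rule fermat_theorem[OF p k(2)])
    then have "int p dvd int (\<Sum>i\<in>I. c k i) ^ (p - 1) - 1"
      by (metis cong_iff_dvd_diff cong_int_iff of_nat_1 of_nat_power)
    then have "int p dvd - (int (\<Sum>i\<in>I. c k i) ^ (p - 1)) + 1"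
      by (metis add.commute diff_conv_add_uminus dvd_minus_iff minus_diff_eq)
    also have "\<dots> dvd F I" unfolding F_def by (rule dvd_prodI) (use k(1) in auto)
    finally show ?thesis .
  qed
  then have "int p dvd (\<Sum>I\<in>Pow S - {{}}. (-1) ^ card I * F I)"
    by (intro dvd_sum dvd_mult) auto
  moreover have "(\<Sum>I\<in>Pow S. (-1) ^ card I * F I) = F {} + (\<Sum>I\<in>Pow S - {{}}. (-1) ^ card I * F I)"
    using S by (subst sum.remove[of _ "{}"]) auto
  moreover have "F {} = 1" unfolding F_def using p1 by (simp add: power_0_left)
  ultimately have "int p dvd 1" using zero by (metis add.commute add_eq_0_iff dvd_minus_iff)
  then show False using p1 by simp
qed

section \<open>Zero-sum subsets in rank two\<close>

lemma exists_zero_sum_subset_pair: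
  fixes c d :: "'a \<Rightarrow> nat"
  assumes p: "prime p" and S: "finite S" "2 * (p - 1) < card S"
  shows "\<exists>I\<subseteq>S. I \<noteq> {} \<and> p dvd sum c I \<and> p dvd sum d I"
proof -
  obtain I where I: "I \<subseteq> S" "I \<noteq> {}" "\<forall>k<2::nat. p dvd (\<Sum>i\<in>I. (if k = 0 then c else d) i)"
    using exists_zero_sum_subset[OF p S, of "\<lambda>k. if k = 0 then c else d"] by blast
  show ?thesis using I(1,2) I(3)[rule_format, of 0] I(3)[rule_format, of 1] by auto
qed

text \<open>A third, constant weight makes the size of the zero-sum set a multiple of
  \<open>p\<close> below \<open>3 * p\<close>. If it is \<open>2 * p\<close>, the set splits into
  two zero-sum parts, one of which has at most \<open>p\<close> elements.\<close>

lemma exists_short_zero_sum_subset: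
  fixes c d :: "'a \<Rightarrow> nat"
  assumes p: "prime p" and S: "finite S" "3 * p - 2 \<le> card S"
  shows "\<exists>I\<subseteq>S. I \<noteq> {} \<and> card I \<le> p \<and> p dvd sum c I \<and> p dvd sum d I"
proof -
  have p1: "p > 1" using prime_gt_1_nat[OF p] .
  obtain S' where S': "S' \<subseteq> S" "card S' = 3 * p - 2" "finite S'"
    using obtain_subset_with_card_n[OF S(2)] by metis
  then have "3 * (p - 1) < card S'" using p1 by simp
  from exists_zero_sum_subset[OF p S'(3) this, of "\<lambda>k. if k = 0 then c else if k = 1 then d else (\<lambda>_. 1)"]
  obtain J where J: "J \<subseteq> S'" "J \<noteq> {}" "\<forall>k<3::nat. p dvd (\<Sum>i\<in>J. (if k = 0 then c else if k = 1 then d else (\<lambda>_. 1)) i)"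
    by blast
  have J': "p dvd sum c J" "p dvd sum d J" "p dvd card J"
    using J(3)[rule_format, of 0] J(3)[rule_format, of 1] J(3)[rule_format, of 2] by simp_all
  have finJ: "finite J" using J(1) S' finite_subset by blast
  have "card J \<le> 3 * p - 2" using card_mono[OF S'(3) J(1)] S' by simp
  moreover obtain q where q: "card J = p * q" using J'(3) by blast
  ultimately have "p * q < p * 3" using p1 by linarith
  then have "q < 3" by simp
  moreover have "q \<noteq> 0" using q J(2) finJ by auto
  ultimately consider "q = 1" | "q = 2" by linarith
  then show ?thesis
  proof cases
    case 1
    then show ?thesis using J J' q S' by (intro exI[of _ J]) auto
  next
    case 2
    obtain x where x: "x \<in> J" using J by blast
    \<comment> \<open>Leaving out \<open>x\<close> keeps the complement of \<open>T\<close>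
      nonempty; the other \<open>2 * p - 1\<close> elements still suffice.\<close>
    have "2 * (p - 1) < card (J - {x})" using q 2 x finJ p1 by (simp add: card_Diff_singleton)
    from exists_zero_sum_subset_pair[OF p _ this, of c d] finJ
    obtain T where T: "T \<subseteq> J - {x}" "T \<noteq> {}" and T': "p dvd sum c T" "p dvd sum d T"
      by blast
    have TJ: "T \<subseteq> J" "finite T" using T(1) finJ finite_subset by blast+
    have compl: "p dvd sum c (J - T)" "p dvd sum d (J - T)"
      using J' T' sum.subset_diff[OF TJ(1) finJ, of c] sum.subset_diff[OF TJ(1) finJ, of d]
      by (metis dvd_add_left_iff)+
    have "card T + card (J - T) = 2 * p"
      using q 2 card_Diff_subset[OF TJ(2,1)] card_mono[OF finJ TJ(1)] by simp
    then consider "card T \<le> p" | "card (J - T) \<le> p" by linarith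
    then show ?thesis
    proof cases
      case 1
      then show ?thesis using T T' TJ J S' by (intro exI[of _ T]) auto
    next
      case 2
      then show ?thesis using T x compl TJ J S' by (intro exI[of _ "J - T"]) auto
    qed
  qed
qed

lemma exists_disjoint_zero_sum_subsets:
  fixes c d :: "'a \<Rightarrow> nat"
  assumes p: "prime p" and S: "finite S" "p * m + p - 1 \<le> card S"
  shows "\<exists>F. disjoint_family_on F {..<m} \<and>
           (\<forall>k<m. F k \<subseteq> S \<and> F k \<noteq> {} \<and> p dvd sum c (F k) \<and> p dvd sum d (F k))"
  using S
proof (induction m arbitrary: S)
  case 0
  then show ?case by (auto simp: disjoint_family_on_def)
next
  case (Suc m)
  have p1: "p > 1" using prime_gt_1_nat[OF p] .
  \<comment> \<open>The last set may have any size and needs only \<open>2 * p - 1\<close> elements.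
    Before that, at least \<open>3 * p - 1\<close> remain, so a short set exists and its removal
    costs at most \<open>p\<close>.\<close>
  have "\<exists>I\<subseteq>S. I \<noteq> {} \<and> p dvd sum c I \<and> p dvd sum d I \<and> (m \<noteq> 0 \<longrightarrow> card I \<le> p)"
  proof (cases "m = 0")
    case True
    then have "2 * (p - 1) < card S" using Suc.prems p1 by simp
    from exists_zero_sum_subset_pair[OF p Suc.prems(1) this] show ?thesis using True by blast
  next
    case False
    then obtain k where "m = Suc k" by (cases m) auto
    then have "3 * p - 2 \<le> card S" using Suc.prems by simp
    then show ?thesis using exists_short_zero_sum_subset[OF p Suc.prems(1)] by metis
  qed
  then obtain I where I: "I \<subseteq> S" "I \<noteq> {}" "p dvd sum c I" "p dvd sum d I" "m \<noteq> 0 \<longrightarrow> card I \<le> p"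
    by blast
  have "\<exists>F. disjoint_family_on F {..<m} \<and>
      (\<forall>k<m. F k \<subseteq> S - I \<and> F k \<noteq> {} \<and> p dvd sum c (F k) \<and> p dvd sum d (F k))"
  proof (cases "m = 0")
    case False
    have "finite I" using I(1) Suc.prems(1) finite_subset by blast
    then have "p * m + p - 1 \<le> card (S - I)"
      using I False Suc.prems card_Diff_subset[of I S] by simp
    then show ?thesis using Suc by blast
  qed (auto simp: disjoint_family_on_def)
  then obtain F where F: "disjoint_family_on F {..<m}"
    "\<And>k. k < m \<Longrightarrow> F k \<subseteq> S - I \<and> F k \<noteq> {} \<and> p dvd sum c (F k) \<and> p dvd sum d (F k)"
    by blast
  have "F k \<inter> I = {}" if "k < m" for k using F(2)[OF that] by blast
  then have "disjoint_family_on (F(m := I)) {..<Suc m}"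
    using F(1) unfolding disjoint_family_on_def lessThan_Suc by (simp add: Int_commute)
  moreover have "\<forall>k<Suc m. (F(m := I)) k \<subseteq> S \<and> (F(m := I)) k \<noteq> {} \<and>
      p dvd sum c ((F(m := I)) k) \<and> p dvd sum d ((F(m := I)) k)"
    using F I by (auto simp: less_Suc_eq)
  ultimately show ?case by blast
qed

text \<open>Pigeonhole: two of the \<open>n + 1\<close> prefix sums agree modulo
  \<open>n\<close>.\<close>

lemma exists_subset_sum_dvd:
  fixes b :: "nat \<Rightarrow> nat"
  assumes "n > 0"
  shows "\<exists>K\<subseteq>{..<n}. K \<noteq> {} \<and> n dvd sum b K"
proof -
  define s where "s k = sum b {..<k} mod n" for k
  have "s ` {..n} \<subseteq> {..<n}" using assms by (auto simp: s_def)
  then have "card (s ` {..n}) \<le> n"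
    using card_mono[of "{..<n}" "s ` {..n}"] by simp
  then have "\<not> inj_on s {..n}"
    using card_image[of s "{..n}"] by auto
  then obtain k l where kl: "k < l" "l \<le> n" "s k = s l"
    unfolding inj_on_def by (metis atMost_iff linorder_neqE_nat)
  have "sum b {..<l} = sum b {..<k} + sum b {k..<l}"
    using kl by (simp add: lessThan_atLeast0 sum.atLeastLessThan_concat)
  then have "n dvd sum b {k..<l}"
    using kl(3) unfolding s_def by (metis add_diff_cancel_left' le_add1 mod_eq_dvd_iff_nat)
  then show ?thesis using kl by (intro exI[of _ "{k..<l}"]) auto
qed

text \<open>Take \<open>n\<close> disjoint subsets that are zero-sum modulo \<open>p\<close>. Their
  \<open>d\<close>-sums divided by \<open>p\<close> are \<open>n\<close> numbers, some of which add
  up to a multiple of \<open>n\<close>; the union of those subsets is as wanted.\<close>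

lemma exists_zero_sum_subset_rank_two:
  fixes c d :: "'a \<Rightarrow> nat"
  assumes p: "prime p" and n: "n > 0" and S: "finite S" "p * n + p - 1 \<le> card S"
  shows "\<exists>I\<subseteq>S. I \<noteq> {} \<and> p dvd sum c I \<and> p * n dvd sum d I"
proof -
  obtain F where F: "disjoint_family_on F {..<n}"
    "\<And>k. k < n \<Longrightarrow> F k \<subseteq> S \<and> F k \<noteq> {} \<and> p dvd sum c (F k) \<and> p dvd sum d (F k)"
    using exists_disjoint_zero_sum_subsets[OF p S, of c d] by blast
  obtain K where K: "K \<subseteq> {..<n}" "K \<noteq> {}" "n dvd (\<Sum>k\<in>K. sum d (F k) div p)"
    using exists_subset_sum_dvd[OF n, of "\<lambda>k. sum d (F k) div p"] by blast
  have fin: "finite K" "\<And>k. k \<in> K \<Longrightarrow> finite (F k)"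
    using K F(2) S(1) finite_subset by (blast intro: finite_subset[of K "{..<n}"])+
  have sums: "sum f (\<Union>k\<in>K. F k) = (\<Sum>k\<in>K. sum f (F k))" for f :: "'a \<Rightarrow> nat"
    using fin F(1) K(1) by (intro sum.UNION_disjoint) (auto simp: disjoint_family_on_def)
  have "sum d (\<Union>k\<in>K. F k) = p * (\<Sum>k\<in>K. sum d (F k) div p)"
    unfolding sums sum_distrib_left using F K by (intro sum.cong) auto
  then have "p * n dvd sum d (\<Union>k\<in>K. F k)" using K(3) by simp
  moreover have "p dvd sum c (\<Union>k\<in>K. F k)"
    unfolding sums using F(2) K(1) by (auto intro!: dvd_sum[where f = "\<lambda>k. sum c (F k)"])
  moreover have "(\<Union>k\<in>K. F k) \<subseteq> S" "(\<Union>k\<in>K. F k) \<noteq> {}"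
    using F(2) K(1,2) by blast+
  ultimately show ?thesis by blast
qed

section \<open>Covering planes by four directions\<close>

lemma sum_card_fibres_le:
  assumes "finite J"
  shows "(\<Sum>k<(n::nat). card {i\<in>J. f i = k}) \<le> card J"
proof -
  have "(\<Sum>k<n. card {i\<in>J. f i = k}) = card (\<Union>k<n. {i\<in>J. f i = k})"
    using assms by (subst card_UN_disjoint) auto
  also have "\<dots> \<le> card J" using assms by (intro card_mono) auto
  finally show ?thesis .
qed

lemma coprime_less_prime:
  fixes p q :: int
  assumes "prime p" "0 < q" "q < p"
  shows "coprime q p"
proof -
  have "\<not> p dvd q" using assms by (simp add: zdvd_not_zless)
  from prime_imp_coprime[OF assms(1) this] show ?thesis by (rule coprime_commute[THEN iffD1])
qed

lemma inj_on_affine_mod: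
  fixes p k t :: int
  assumes "coprime k p"
  shows "inj_on (\<lambda>x. (k * x + t) mod p) {0..<p}"
proof (rule inj_onI)
  fix x y assume xy: "x \<in> {0..<p}" "y \<in> {0..<p}" "(k * x + t) mod p = (k * y + t) mod p"
  then have "[k * x = k * y] (mod p)" by (metis cong_add_rcancel cong_def)
  then have "[x = y] (mod p)" using assms by (simp add: cong_mult_lcancel)
  then show "x = y" using xy by (simp add: cong_def)
qed

lemma card_affine_preimage_le:
  fixes p k t :: int
  assumes "coprime k p" "finite R"
  shows "card ({0..<p} \<inter> {x. (k * x + t) mod p \<in> R}) \<le> card R"
proof (rule card_inj_on_le)
  show "inj_on (\<lambda>x. (k * x + t) mod p) ({0..<p} \<inter> {x. (k * x + t) mod p \<in> R})"
    by (rule inj_on_subset[OF inj_on_affine_mod[OF assms(1)]]) simp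
qed (use assms in auto)

text \<open>Here \<open>x\<close> runs along a line. Multiplication by a unit is injective, so each
  of three families of other directions meets the line in at most as many points as it has
  constants.\<close>

lemma card_le_of_affine_cover:
  fixes p :: int
  assumes "coprime k1 p" "coprime k2 p" "coprime k3 p" and fin: "finite R1" "finite R2" "finite R3"
    and cover: "\<And>x. x \<in> {0..<p} \<Longrightarrow>
      (k1 * x + t1) mod p \<in> R1 \<or> (k2 * x + t2) mod p \<in> R2 \<or> (k3 * x + t3) mod p \<in> R3"
  shows "nat p \<le> card R1 + card R2 + card R3"
proof -
  let ?P = "\<lambda>k t R. {0..<p} \<inter> {x. (k * x + t) mod p \<in> R}"
  have "{0..<p} \<subseteq> ?P k1 t1 R1 \<union> ?P k2 t2 R2 \<union> ?P k3 t3 R3" using cover by blast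
  then have "card {0..<p} \<le> card (?P k1 t1 R1 \<union> ?P k2 t2 R2 \<union> ?P k3 t3 R3)"
    by (intro card_mono) auto
  also have "\<dots> \<le> card (?P k1 t1 R1) + card (?P k2 t2 R2) + card (?P k3 t3 R3)"
    by (meson add_le_mono1 card_Un_le order_trans)
  also have "\<dots> \<le> card R1 + card R2 + card R3"
    using assms by (intro add_mono card_affine_preimage_le) auto
  finally show ?thesis by simp
qed

text \<open>\<open>R j\<close> contains the constants \<open>r\<close> of the lines \<open>j x + y = r\<close> of direction \<open>j\<close>.\<close>

definition lines_cover :: "int \<Rightarrow> (nat \<Rightarrow> int set) \<Rightarrow> bool" where
  "lines_cover p R \<longleftrightarrow> (\<forall>x y. \<exists>j\<le>3. (int j * x + y) mod p \<in> R j)"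

lemma lines_cover_iff:
  "lines_cover p R \<longleftrightarrow> (\<forall>x y. y mod p \<in> R 0 \<or> (x + y) mod p \<in> R 1 \<or>
     (2 * x + y) mod p \<in> R 2 \<or> (3 * x + y) mod p \<in> R 3)"
proof -
  have "(\<exists>j\<le>3::nat. P j) \<longleftrightarrow> P 0 \<or> P 1 \<or> P 2 \<or> P 3" for P
    by (auto simp: numeral_eq_Suc le_Suc_eq)
  then show ?thesis unfolding lines_cover_def by simp
qed

lemma exists_residue_notin:
  fixes p :: int
  assumes "finite R" "card R < nat p"
  shows "\<exists>t\<in>{0..<p}. t \<notin> R"
proof (rule ccontr)
  assume "\<not> ?thesis"
  then have "card {0..<p} \<le> card R" using assms by (intro card_mono) auto
  then show False using assms by simp
qed

text \<open>A line outside the cover meets each line of the cover in at most one point, and none of its own direction.\<close>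

lemma lines_cover_card:
  fixes p :: int
  assumes p: "prime p" "p \<ge> 5" and fin: "\<And>j. finite (R j)" and cover: "lines_cover p R"
  shows "card (R 0) < nat p \<Longrightarrow> nat p \<le> card (R 1) + card (R 2) + card (R 3)"
    and "card (R 1) < nat p \<Longrightarrow> nat p \<le> card (R 0) + card (R 2) + card (R 3)"
    and "card (R 2) < nat p \<Longrightarrow> nat p \<le> card (R 0) + card (R 1) + card (R 3)"
proof -
  note C = cover[unfolded lines_cover_iff, rule_format]
  note cop = coprime_less_prime[OF p(1), of 2] coprime_less_prime[OF p(1), of 3]
  show "nat p \<le> card (R 1) + card (R 2) + card (R 3)" if "card (R 0) < nat p"
  proof -
    from exists_residue_notin[OF fin that] obtain t where t: "t \<in> {0..<p}" "t \<notin> R 0" by blast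
    show ?thesis
    proof (rule card_le_of_affine_cover[of 1 p 2 3 _ _ _ t t t])
      fix x
      show "(1 * x + t) mod p \<in> R 1 \<or> (2 * x + t) mod p \<in> R 2 \<or> (3 * x + t) mod p \<in> R 3"
        using C[of t x] t by simp
    qed (use cop p fin in simp_all)
  qed
  show "nat p \<le> card (R 0) + card (R 2) + card (R 3)" if "card (R 1) < nat p"
  proof -
    from exists_residue_notin[OF fin that] obtain t where t: "t \<in> {0..<p}" "t \<notin> R 1" by blast
    show ?thesis
    proof (rule card_le_of_affine_cover[of "-1" p 1 2 _ _ _ t t t])
      fix x
      show "(-1 * x + t) mod p \<in> R 0 \<or> (1 * x + t) mod p \<in> R 2 \<or> (2 * x + t) mod p \<in> R 3"
        \<comment> \<open>The points of the missing line \<open>x + y = t\<close> are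
          \<open>(x, t - x)\<close>; \<open>C\<close> takes the second coordinate first.\<close>
        using C[of "t - x" x] t by (simp add: algebra_simps)
    qed (use cop p fin in simp_all)
  qed
  show "nat p \<le> card (R 0) + card (R 1) + card (R 3)" if "card (R 2) < nat p"
  proof -
    from exists_residue_notin[OF fin that] obtain t where t: "t \<in> {0..<p}" "t \<notin> R 2" by blast
    show ?thesis
    proof (rule card_le_of_affine_cover[of "-2" p "-1" 1 _ _ _ t t t])
      fix x
      show "(-2 * x + t) mod p \<in> R 0 \<or> (-1 * x + t) mod p \<in> R 1 \<or> (1 * x + t) mod p \<in> R 3"
        using C[of "t - 2 * x" x] t by (simp add: algebra_simps)
    qed (use cop p fin in simp_all)
  qed
qed

text \<open>
  In this extremal case the counts are tight, which forces the complement of \<open>R 0\<close> to be invariant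
  under translation by the difference of two elements of \<open>R 2\<close>.
\<close>

lemma not_lines_cover_half:
  fixes p :: int
  assumes p: "prime p" "p \<ge> 5" and R: "\<And>j. R j \<subseteq> {0..<p}"
    and card: "2 * card (R 0) + 1 = nat p" "card (R 1) = card (R 0)" "card (R 2) = card (R 0)"
      "card (R 3) \<le> 1"
  shows "\<not> lines_cover p R"
proof
  assume "lines_cover p R"
  note C = this[unfolded lines_cover_iff, rule_format]
  have fin: "finite (R j)" for j using R finite_subset by blast
  have cop: "coprime 2 p" by (rule coprime_less_prime[OF p(1)]) (use p(2) in simp_all)
  \<comment> \<open>The line \<open>x + y = v\<close> is missing, and \<open>u\<close> is the second
    coordinate on it. If \<open>R 0\<close> already hit its point with \<open>2 * x + y = c\<close>,
    then \<open>c\<close> could be dropped from \<open>R 2\<close>, for which the counts leave no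
    room.\<close>
  have notin: "(2 * v - c) mod p \<notin> R 0" if "c \<in> R 2" "v mod p \<notin> R 1" for v c
  proof
    assume c: "(2 * v - c) mod p \<in> R 0"
    have "nat p \<le> card (R 0) + card (R 2 - {c}) + card (R 3)"
    proof (rule card_le_of_affine_cover[of 1 p "-1" "-2" _ _ _ 0 "2 * v" "3 * v"])
      fix u assume u: "u \<in> {0..<p}"
      have "(2 * v - u) mod p = c \<Longrightarrow> u = (2 * v - c) mod p"
        using u by (auto simp: mod_diff_right_eq)
      then show "(1 * u + 0) mod p \<in> R 0 \<or> (-1 * u + 2 * v) mod p \<in> R 2 - {c} \<or> (-2 * u + 3 * v) mod p \<in> R 3"
        using C[of u "v - u"] that(2) c u by (auto simp: algebra_simps)
    qed (use cop p fin in simp_all)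
    moreover have "card (R 0) > 0" using card p by linarith
    ultimately show False using card that fin[of 2] by (simp add: card_Diff_singleton)
  qed
  let ?A = "{0..<p} - R 0" and ?B = "{0..<p} - R 1"
  have AB: "card ?A = card ?B"
    using card R fin by (simp add: card_Diff_subset)
  \<comment> \<open>An injective map between sets of equal size is onto, and this for every
    \<open>c\<close> in \<open>R 2\<close>.\<close>
  have img: "(\<lambda>v. (2 * v + (-c)) mod p) ` ?B = ?A" if c: "c \<in> R 2" for c
  proof (rule card_subset_eq)
    show "(\<lambda>v. (2 * v + - c) mod p) ` ?B \<subseteq> ?A" using notin[OF c] p by auto
    show "card ((\<lambda>v. (2 * v + - c) mod p) ` ?B) = card ?A"
      unfolding AB by (intro card_image inj_on_subset[OF inj_on_affine_mod[OF cop]]) auto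
  qed simp
  have "card (R 2) \<ge> 2" using card p by linarith
  then obtain C where "C \<subseteq> R 2" "card C = 2" by (rule obtain_subset_with_card_n)
  then obtain c1 c2 where c: "c1 \<in> R 2" "c2 \<in> R 2" "c1 \<noteq> c2" by (auto simp: card_2_iff)
  \<comment> \<open>If \<open>u\<close> is \<open>2 * v - c1\<close>, the shift leads to
    \<open>2 * v - c2\<close>, which avoids \<open>R 0\<close> as well.\<close>
  have shift: "(u + (c1 - c2)) mod p \<notin> R 0" if "u mod p \<notin> R 0" for u
  proof -
    have "u mod p \<in> ?A" using that p by simp
    then obtain v where v: "u mod p = (2 * v + - c1) mod p" "v \<in> ?B"
      unfolding img[OF c(1), symmetric] by (rule imageE)
    have "(u + (c1 - c2)) mod p = (2 * v - c2) mod p"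
      using v(1) mod_add_left_eq[of u p "c1 - c2"] mod_add_left_eq[of "2 * v - c1" p "c1 - c2"] by simp
    then show ?thesis using notin[OF c(2), of v] v(2) by simp
  qed
  have shifts: "(u + int k * (c1 - c2)) mod p \<notin> R 0" if "u mod p \<notin> R 0" for u k
  proof (induction k)
    case (Suc k)
    have "u + int (Suc k) * (c1 - c2) = (u + int k * (c1 - c2)) + (c1 - c2)"
      by (simp add: algebra_simps)
    then show ?case using shift[OF Suc.IH] by (simp only: not_False_eq_True)
  qed (use that in simp)
  have "\<not> p dvd c1 - c2"
  proof
    assume "p dvd c1 - c2"
    then have "c1 mod p = c2 mod p" by (simp add: mod_eq_dvd_iff)
    moreover have "c1 \<in> {0..<p}" "c2 \<in> {0..<p}" using c(1,2) R[of 2] by blast+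
    ultimately show False using c(3) by simp
  qed
  from prime_imp_coprime[OF p(1) this] have "coprime (c1 - c2) p"
    by (rule coprime_commute[THEN iffD1])
  \<comment> \<open>The difference is a unit modulo \<open>p\<close>, so repeated shifts lead from
    \<open>u\<close> outside \<open>R 0\<close> to \<open>w\<close> inside it.\<close>
  then obtain z where z: "[(c1 - c2) * z = 1] (mod p)" using cong_solve_coprime_int by blast
  have "card (R 0) > 0" "card (R 0) < nat p" using card p by linarith+
  then obtain w u where w: "w \<in> R 0" and u: "u \<in> {0..<p}" "u \<notin> R 0"
    using exists_residue_notin[OF fin, of 0] by (metis card.empty all_not_in_conv less_irrefl)
  have "[u + int (nat ((w - u) * z mod p)) * (c1 - c2) = u + ((w - u) * z) * (c1 - c2)] (mod p)"
    using p by (intro cong_add cong_mult) (auto simp: cong_def)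
  also have "[u + ((w - u) * z) * (c1 - c2) = u + (w - u) * 1] (mod p)"
    using cong_scalar_left[OF z, of "w - u"] by (intro cong_add cong_refl) (simp add: ac_simps)
  finally show False
    using shifts[of u "nat ((w - u) * z mod p)"] w u R[of 0] by (auto simp: cong_def subset_iff)
qed

text \<open>
  Covering a plane without a full parallel class of direction \<open>0\<close> takes about \<open>3 p / 2\<close> lines of the
  first three directions. There are at least two such planes, and the number of lines only
  admits the case in which there are exactly two and the bound is attained for both.
\<close>

lemma exists_uncovered_point:
  fixes p n :: nat and cl f :: "'i \<Rightarrow> nat" and r :: "'i \<Rightarrow> int"
  assumes p: "prime p" "p \<ge> 5" and n: "n \<ge> 2" and I: "finite I"
    and card: "card {i\<in>I. cl i = 0} = (n - 1) * p - 1" "card {i\<in>I. cl i = 1} = p - 1"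
      "card {i\<in>I. cl i = 2} = p - 1" "card {i\<in>I. cl i = 3} = 2"
  shows "\<exists>k<n. \<exists>x y. \<forall>i\<in>I. cl i \<le> 3 \<longrightarrow> f i = k \<longrightarrow> (int (cl i) * x + y) mod int p \<noteq> r i mod int p"
proof (rule ccontr)
  assume no: "\<not> ?thesis"
  define N where "N j k = card {i\<in>{i\<in>I. cl i = j}. f i = k}" for j k
  define R where "R k j = (\<lambda>i. r i mod int p) ` {i\<in>{i\<in>I. cl i = j}. f i = k}" for k j
  have p0: "prime (int p)" "int p \<ge> 5" using p by auto
  have fin: "finite (R k j)" for k j unfolding R_def using I by auto
  have RN: "card (R k j) \<le> N j k" for k j unfolding R_def N_def using I by (intro card_image_le) auto
  have Rsub: "R k j \<subseteq> {0..<int p}" for k j unfolding R_def using p by auto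
  have cover: "lines_cover (int p) (R k)" if k: "k < n" for k
    unfolding lines_cover_def
  proof (intro allI)
    fix x y
    from no k obtain i where "i \<in> I" "cl i \<le> 3" "f i = k" "(int (cl i) * x + y) mod int p = r i mod int p"
      by blast
    then show "\<exists>j\<le>3. (int j * x + y) mod int p \<in> R k j"
      unfolding R_def by (intro exI[of _ "cl i"]) auto
  qed
  have "(\<Sum>k<n. N j k) \<le> card {i\<in>I. cl i = j}" for j
    unfolding N_def by (rule sum_card_fibres_le) (use I in simp)
  from this[of 0] this[of 1] this[of 2] this[of 3]
  have sums: "(\<Sum>k<n. N 0 k) \<le> (n - 1) * p - 1" "(\<Sum>k<n. N 1 k) \<le> p - 1"
      "(\<Sum>k<n. N 2 k) \<le> p - 1" "(\<Sum>k<n. N 3 k) \<le> 2"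
    unfolding card by simp_all
  have small: "N 1 k < p" "N 2 k < p" if "k < n" for k
    using member_le_sum[of k "{..<n}" "N 1"] member_le_sum[of k "{..<n}" "N 2"] sums that p by auto
  \<comment> \<open>Only outside \<open>T\<close> can direction \<open>0\<close> alone cover a
    plane.\<close>
  define T where "T = {k. k < n \<and> N 0 k < p}"
  have Tfin: "finite T" "T \<subseteq> {..<n}" unfolding T_def by auto
  have pairs: "p \<le> N 1 k + N 2 k + N 3 k" "p \<le> N 0 k + N 2 k + N 3 k" "p \<le> N 0 k + N 1 k + N 3 k"
    if "k \<in> T" for k
    using that small[of k] lines_cover_card[OF p0 fin cover, of k] RN[of k 0] RN[of k 1] RN[of k 2] RN[of k 3]
    unfolding T_def by simp_all
  have restr: "(\<Sum>k\<in>T. N j k) \<le> (\<Sum>k<n. N j k)" for j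
    using Tfin by (intro sum_mono2) auto
  have cT: "card T \<le> n" using card_mono[OF _ Tfin(2)] by simp
  have full: "(n - card T) * p + (\<Sum>k\<in>T. N 0 k) \<le> (n - 1) * p - 1"
  proof -
    have "(n - card T) * p = (\<Sum>k\<in>{..<n} - T. p)" using Tfin by (simp add: card_Diff_subset)
    also have "\<dots> \<le> (\<Sum>k\<in>{..<n} - T. N 0 k)" unfolding T_def by (intro sum_mono) auto
    finally show ?thesis using sums(1) sum.subset_diff[OF Tfin(2), of "N 0"] by simp
  qed
  \<comment> \<open>Direction \<open>0\<close> is one line short of filling \<open>n - 1\<close>
    planes.\<close>
  have "card T \<ge> 2"
  proof (rule ccontr)
    assume "\<not> card T \<ge> 2"
    then have "(n - 1) * p \<le> (n - card T) * p" by (intro mult_right_mono) auto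
    moreover have "(n - 1) * p > 0" using n p by simp
    ultimately show False using full by linarith
  qed
  \<comment> \<open>The three inequalities in \<open>pairs\<close> are added up, over all planes in
    \<open>T\<close>.\<close>
  have "3 * (card T * p) = (\<Sum>k\<in>T. 3 * p)" by simp
  also have "\<dots> \<le> (\<Sum>k\<in>T. 2 * N 0 k + 2 * N 1 k + 2 * N 2 k + 3 * N 3 k)"
    using pairs by (intro sum_mono) fastforce
  also have "\<dots> = 2 * (\<Sum>k\<in>T. N 0 k) + 2 * (\<Sum>k\<in>T. N 1 k) + 2 * (\<Sum>k\<in>T. N 2 k) + 3 * (\<Sum>k\<in>T. N 3 k)"
    by (simp add: sum.distrib sum_distrib_left)
  finally have total: "3 * (card T * p) \<le> \<dots>" .
  have "(n - card T) * p + card T * p = n * p" using cT by (simp add: add_mult_distrib[symmetric])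
  moreover have "(n - 1) * p + p = n * p" using n by (cases n) auto
  moreover have "(n - 1) * p > 0" using n p by simp
  ultimately have sum0: "(\<Sum>k\<in>T. N 0 k) + p + 1 \<le> card T * p"
    using full by linarith
  \<comment> \<open>With \<open>t = card T\<close>, the available lines give
    \<open>3 * t * p \<le> 2 * (t * p - p - 1) + 4 * (p - 1) + 6\<close>.\<close>
  have "card T * p \<le> 2 * p"
    using total sum0 sums(2,3,4) restr[of 1] restr[of 2] restr[of 3] p by linarith
  then have "card T = 2" using \<open>card T \<ge> 2\<close> p by simp
  then obtain k l where kl: "T = {k, l}" "k \<noteq> l" by (meson card_2_iff)
  have odd: "odd p" using p prime_odd_nat[of p] by simp
  have b: "N 0 k + N 0 l + p + 1 \<le> 2 * p" "N 1 k + N 1 l \<le> p - 1" "N 2 k + N 2 l \<le> p - 1" "N 3 k + N 3 l \<le> 2"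
    using sum0 sums(2-) restr[of 1] restr[of 2] restr[of 3] kl by auto
  \<comment> \<open>For two planes all these inequalities are equalities. That \<open>p\<close> is
    odd then forces \<open>N 3 k = 1\<close>.\<close>
  have "N 1 k = N 0 k" "N 2 k = N 0 k" "2 * N 0 k + N 3 k = p" "N 3 k \<le> 2"
    using b pairs[of k] pairs[of l] kl p by auto
  with odd have Nk: "N 1 k = N 0 k" "N 2 k = N 0 k" "2 * N 0 k + 1 = p" "N 3 k = 1"
    by presburger+
  have kn: "k < n" "N 0 k < p" using kl T_def by auto
  \<comment> \<open>The lower bounds of \<open>lines_cover_card\<close> are met with equality, so no
    constant occurs twice.\<close>
  have "card (R k 0) = N 0 k" "card (R k 1) = N 0 k" "card (R k 2) = N 0 k"
    using lines_cover_card[OF p0 fin cover[OF kn(1)]] RN[of k 0] RN[of k 1] RN[of k 2] RN[of k 3] Nk kn small[OF kn(1)]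
    by auto
  then show False
    using not_lines_cover_half[OF p0, of "R k"] Rsub[of k] cover[OF kn(1)] RN[of k 3] Nk by simp
qed

section \<open>Covering planes for \<open>p \<le> 3\<close>\<close>

text \<open>The \<open>p + 1\<close> directions of the affine plane over the integers modulo \<open>p\<close>; direction \<open>p\<close> is the vertical one.\<close>

definition line_form :: "nat \<Rightarrow> nat \<Rightarrow> nat \<Rightarrow> nat \<Rightarrow> nat" where
  "line_form p j x y = (if j < p then j * x + y else x) mod p"

definition plane_covered :: "nat \<Rightarrow> ('i \<Rightarrow> nat) \<Rightarrow> ('i \<Rightarrow> nat) \<Rightarrow> 'i set \<Rightarrow> bool" where
  "plane_covered p cl r J \<longleftrightarrow> (\<forall>x<p. \<forall>y<p. \<exists>i\<in>J. line_form p (cl i) x y = r i)"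

lemma plane_covered_mono: "plane_covered p cl r J \<Longrightarrow> J \<subseteq> J' \<Longrightarrow> plane_covered p cl r J'"
  unfolding plane_covered_def by blast

lemma plane_covered_cong:
  "(\<And>i. i \<in> J \<Longrightarrow> r i = r' i) \<Longrightarrow> plane_covered p cl r J \<longleftrightarrow> plane_covered p cl r' J"
  unfolding plane_covered_def by simp

text \<open>With distinct constants, the \<open>p\<close> parallel lines partition the
  plane.\<close>

lemma plane_covered_parallel_class:
  assumes "finite J" "card J = p" "\<And>i. i \<in> J \<Longrightarrow> cl i = j"
  shows "\<exists>r. plane_covered p cl r J"
proof -
  obtain b where b: "bij_betw b J {..<p}"
    using ex_bij_betw_finite_nat[OF assms(1)] assms(2) by (auto simp: lessThan_atLeast0)
  have "\<exists>i\<in>J. line_form p (cl i) x y = b i" if "x < p" for x y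
  proof -
    have "line_form p j x y \<in> b ` J"
      using that bij_betw_imp_surj_on[OF b] by (simp add: line_form_def)
    then show ?thesis using assms(3) by fastforce
  qed
  then show ?thesis unfolding plane_covered_def by blast
qed

text \<open>Every point is on a line through the origin; for these two primes this is checked by
  evaluation.\<close>

lemma plane_covered_pencil:
  assumes p: "p = 2 \<or> p = 3" and J: "\<And>j. j \<le> p \<Longrightarrow> \<exists>i\<in>J. cl i = j"
  shows "plane_covered p cl (\<lambda>_. 0) J"
proof -
  have two: "{..<2} = {0, 1::nat}" "{..2} = {0, 1, 2::nat}"
    and three: "{..<3} = {0, 1, 2::nat}" "{..3} = {0, 1, 2, 3::nat}" by auto
  have "\<forall>x\<in>{..<2}. \<forall>y\<in>{..<2}. \<exists>j\<in>{..2}. line_form 2 j x y = 0"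
    unfolding two by (simp add: line_form_def)
  moreover have "\<forall>x\<in>{..<3}. \<forall>y\<in>{..<3}. \<exists>j\<in>{..3}. line_form 3 j x y = 0"
    unfolding three by (simp add: line_form_def)
  ultimately have *: "\<forall>x\<in>{..<p}. \<forall>y\<in>{..<p}. \<exists>j\<in>{..p}. line_form p j x y = 0"
    using p by blast
  show ?thesis
    unfolding plane_covered_def
  proof (intro allI impI)
    fix x y assume "x < p" "y < p"
    then obtain j where j: "j \<le> p" "line_form p j x y = 0" using * by auto
    from J[OF j(1)] obtain i where "i \<in> J" "cl i = j" ..
    with j(2) show "\<exists>i\<in>J. line_form p (cl i) x y = 0" by auto
  qed
qed

text \<open>Once the constants \<open>0\<close> and \<open>1\<close> are used in two directions,
  only the intersection of the two lines with constant \<open>2\<close> stays uncovered.\<close>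

lemma lines_meet_once:
  assumes "j1 \<le> 3" "j2 \<le> 3" "j1 \<noteq> j2"
  shows "\<exists>x0 y0. \<forall>x<3. \<forall>y<3. line_form 3 j1 x y \<notin> {0, 1} \<longrightarrow> line_form 3 j2 x y \<notin> {0, 1} \<longrightarrow> x = x0 \<and> y = y0"
proof -
  have three: "{..<3} = {0, 1, 2::nat}" "{..3} = {0, 1, 2, 3::nat}" by auto
  have "\<forall>j1\<in>{..3}. \<forall>j2\<in>{..3}. j1 \<noteq> j2 \<longrightarrow> (\<exists>x0\<in>{..<3}. \<exists>y0\<in>{..<3}. \<forall>x\<in>{..<3}. \<forall>y\<in>{..<3}.
      line_form 3 j1 x y \<notin> {0, 1} \<longrightarrow> line_form 3 j2 x y \<notin> {0, 1} \<longrightarrow> x = x0 \<and> y = y0)"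
    unfolding three by (simp add: line_form_def)
  with assms obtain x0 y0 where "\<forall>x\<in>{..<3}. \<forall>y\<in>{..<3}.
      line_form 3 j1 x y \<notin> {0, 1} \<longrightarrow> line_form 3 j2 x y \<notin> {0, 1} \<longrightarrow> x = x0 \<and> y = y0"
    unfolding atMost_iff[symmetric] by blast
  then show ?thesis unfolding lessThan_iff[symmetric] by blast
qed

text \<open>If every direction occurs, a pencil covers the plane. Otherwise three directions have
  multiplicities \<open>2\<close>, \<open>2\<close> and at least \<open>1\<close>: the two pairs
  leave one point, and a line of the third direction is put through it.\<close>

lemma plane_covered_five:
  assumes J: "finite J" "\<And>j. card {i\<in>J. cl i = j} \<le> 2" "5 \<le> card J" "cl ` J \<subseteq> {..3}"
  shows "\<exists>r. plane_covered 3 cl r J"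
proof (cases "\<forall>j\<le>3. \<exists>i\<in>J. cl i = j")
  case True
  then show ?thesis using plane_covered_pencil[of 3 J cl] by auto
next
  case False
  define N where "N j = card {i\<in>J. cl i = j}" for j
  have "card J = (\<Sum>j\<le>3. N j)"
    using sum.group[OF J(1) _ J(4), of "\<lambda>_. 1::nat"] by (simp add: N_def)
  then have five: "5 \<le> N 0 + N 1 + N 2 + N 3" using J(3) by (simp add: numeral_eq_Suc)
  have le2: "N j \<le> 2" for j using J(2) by (simp add: N_def)
  have pick: "\<exists>j1\<le>3. \<exists>j2\<le>3. \<exists>j3\<le>3. j1 \<noteq> j2 \<and> j1 \<noteq> j3 \<and> j2 \<noteq> j3 \<and> N j1 = 2 \<and> N j2 = 2 \<and> N j3 > 0"
    if xyz: "x \<le> 3" "y \<le> 3" "z \<le> 3" "x \<noteq> y" "x \<noteq> z" "y \<noteq> z" "5 \<le> N x + N y + N z" for x y z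
  proof -
    consider "N x = 2" "N y = 2" "N z > 0" | "N x = 2" "N z = 2" "N y > 0" | "N y = 2" "N z = 2" "N x > 0"
      using xyz(7) le2[of x] le2[of y] le2[of z] by linarith
    then show ?thesis
    proof cases
      case 1
      then show ?thesis using xyz by (intro exI[of _ x] conjI exI[of _ y] exI[of _ z]) auto
    next
      case 2
      then show ?thesis using xyz by (intro exI[of _ x] conjI exI[of _ z] exI[of _ y]) auto
    next
      case 3
      then show ?thesis using xyz by (intro exI[of _ y] conjI exI[of _ z] exI[of _ x]) auto
    qed
  qed
  obtain j0 where "j0 \<le> 3" "N j0 = 0" using False J(1) by (auto simp: N_def)
  then consider "N 0 = 0" | "N 1 = 0" | "N 2 = 0" | "N 3 = 0"
    by (auto simp: numeral_eq_Suc le_Suc_eq)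
  then have "\<exists>j1\<le>3. \<exists>j2\<le>3. \<exists>j3\<le>3. j1 \<noteq> j2 \<and> j1 \<noteq> j3 \<and> j2 \<noteq> j3 \<and> N j1 = 2 \<and> N j2 = 2 \<and> N j3 > 0"
  proof cases
    case 1
    then show ?thesis using pick[of 1 2 3] five by simp
  next
    case 2
    then show ?thesis using pick[of 0 2 3] five by simp
  next
    case 3
    then show ?thesis using pick[of 0 1 3] five by simp
  next
    case 4
    then show ?thesis using pick[of 0 1 2] five by simp
  qed
  then obtain j1 j2 j3 where j: "j1 \<le> 3" "j2 \<le> 3" "j3 \<le> 3" "j1 \<noteq> j2" "j1 \<noteq> j3" "j2 \<noteq> j3"
    "N j1 = 2" "N j2 = 2" "N j3 > 0" by blast
  obtain a a' where a: "{i\<in>J. cl i = j1} = {a, a'}" "a \<noteq> a'" using j(7) unfolding N_def by (meson card_2_iff)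
  obtain b b' where b: "{i\<in>J. cl i = j2} = {b, b'}" "b \<noteq> b'" using j(8) unfolding N_def by (meson card_2_iff)
  obtain c where c: "c \<in> J" "cl c = j3" using j(9) unfolding N_def by (auto simp: card_gt_0_iff)
  have cls: "a \<in> J" "a' \<in> J" "b \<in> J" "b' \<in> J" "cl a = j1" "cl a' = j1" "cl b = j2" "cl b' = j2"
    using a b by blast+
  obtain x0 y0 where "\<And>x y. x < 3 \<Longrightarrow> y < 3 \<Longrightarrow>
      line_form 3 j1 x y \<notin> {0, 1} \<Longrightarrow> line_form 3 j2 x y \<notin> {0, 1} \<Longrightarrow> x = x0 \<and> y = y0"
    using lines_meet_once[OF j(1,2,4)] by blast
  then have s: "line_form 3 j1 x y \<in> {0, 1} \<or> line_form 3 j2 x y \<in> {0, 1} \<or>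
      line_form 3 j3 x y = line_form 3 j3 x0 y0" if "x < 3" "y < 3" for x y
    using that by blast
  define r where "r i = (if i \<in> {a, b} then 0 else if i \<in> {a', b'} then 1 else line_form 3 j3 x0 y0)" for i
  have "r a = 0" "r a' = 1" "r b = 0" "r b' = 1" "r c = line_form 3 j3 x0 y0"
    using a(2) b(2) cls c(2) j(4-6) unfolding r_def by auto
  then have "plane_covered 3 cl r J"
    unfolding plane_covered_def using s cls c by (metis insertE singletonD)
  then show ?thesis by blast
qed

text \<open>With at most \<open>p - 1\<close> lines in each of \<open>p + 1\<close> directions, there are fewer than \<open>p\<close> planes.\<close>

lemma planes_covered_few:
  fixes p :: nat
  assumes p: "p = 2 \<or> p = 3" and I: "finite I" "p * Suc n + p - 1 \<le> card I" "cl ` I \<subseteq> {..p}"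
    and small: "\<And>j. card {i\<in>I. cl i = j} < p"
  shows "\<exists>f r. \<forall>k<Suc n. plane_covered p cl r {i\<in>I. f i = k}"
proof -
  have p_pos: "0 < p" using p by auto
  have sum: "card I = (\<Sum>j\<le>p. card {i\<in>I. cl i = j})"
    using sum.group[OF I(1) _ I(3), of "\<lambda>_. 1::nat"] by simp
  also have "\<dots> \<le> (\<Sum>j\<le>p. p - 1)" using small by (intro sum_mono) (metis Suc_pred' less_Suc_eq_le p_pos)
  finally have le: "card I \<le> (p + 1) * (p - 1)" by simp
  \<comment> \<open>The upper bound \<open>(p + 1) * (p - 1)\<close> is \<open>3\<close> or
    \<open>8\<close>, the lower one \<open>p * Suc n + p - 1\<close>.\<close>
  consider "p = 2" "n = 0" "card I = 3" | "p = 3" "n = 0" "5 \<le> card I" | "p = 3" "n = 1" "card I = 8"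
    using p le I(2) by (elim disjE) (auto, linarith+)
  then show ?thesis
  proof cases
    case 1
    have le1: "card {i\<in>I. cl i = j} \<le> 1" for j using small[of j] 1 by simp
    have "\<exists>i\<in>I. cl i = j" if "j \<le> 2" for j
    proof (rule ccontr)
      assume "\<not> ?thesis"
      then have "card {i\<in>I. cl i = j} = 0" using I(1) by auto
      then have "(\<Sum>j\<le>2. card {i\<in>I. cl i = j}) < (\<Sum>j\<le>2::nat. 1)"
        using le1 that by (intro sum_strict_mono_ex1) auto
      then show False using sum 1 by simp
    qed
    then show ?thesis using 1 plane_covered_pencil[of 2 I cl] by (intro exI[of _ "\<lambda>_. 0"]) auto
  next
    case 2
    then obtain r where "plane_covered 3 cl r I"
      using plane_covered_five[of I cl] I small by (metis less_Suc_eq_le numeral_3_eq_3 numeral_2_eq_2)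
    then show ?thesis using 2 by (intro exI[of _ "\<lambda>_. 0"] exI[of _ r]) auto
  next
    case 3
    have le2: "card {i\<in>I. cl i = j} \<le> 2" for j using small[of j] 3 by simp
    have two: "card {i\<in>I. cl i = j} = 2" if "j \<le> 3" for j
    proof (rule ccontr)
      assume "\<not> ?thesis"
      then have "card {i\<in>I. cl i = j} < 2" using le2[of j] by simp
      then have "(\<Sum>j\<le>3. card {i\<in>I. cl i = j}) < (\<Sum>j\<le>3::nat. 2)"
        using le2 that by (intro sum_strict_mono_ex1) auto
      then show False using sum 3 by simp
    qed
    have "\<exists>a b. a \<in> I \<and> b \<in> I \<and> a \<noteq> b \<and> cl a = j \<and> cl b = j" if "j \<le> 3" for j
      using two[OF that] unfolding card_2_iff by blast
    then obtain a b where ab: "\<And>j. j \<le> 3 \<Longrightarrow> a j \<in> I \<and> b j \<in> I \<and> a j \<noteq> b j \<and> cl (a j) = j \<and> cl (b j) = j"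
      by metis
    \<comment> \<open>Each direction has exactly two lines, one for each plane, which gives two
      pencils.\<close>
    define f :: "'a \<Rightarrow> nat" where "f i = (if i = a (cl i) then 0 else 1)" for i
    have "plane_covered 3 cl (\<lambda>_. 0) {i\<in>I. f i = k}" if "k < 2" for k
    proof (rule plane_covered_pencil)
      fix j :: nat assume "j \<le> 3"
      from ab[OF this] show "\<exists>i\<in>{i\<in>I. f i = k}. cl i = j"
        using that by (intro bexI[of _ "if k = 0 then a j else b j"]) (auto simp: f_def)
    qed simp
    then show ?thesis using 3 by (intro exI[of _ f] exI[of _ "\<lambda>_. 0"]) simp
  qed
qed

lemma exists_planes_covered:
  fixes p n :: nat
  assumes p: "p = 2 \<or> p = 3" and I: "finite I" "p * n + p - 1 \<le> card I" "cl ` I \<subseteq> {..p}"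
  shows "\<exists>f r. \<forall>k<n. plane_covered p cl r {i\<in>I. f i = k}"
  using I
proof (induction n arbitrary: I)
  case (Suc n)
  show ?case
  proof (cases "\<exists>j. p \<le> card {i\<in>I. cl i = j}")
    case True
    then obtain j where "p \<le> card {i\<in>I. cl i = j}" ..
    then obtain J where J: "J \<subseteq> {i\<in>I. cl i = j}" "card J = p" "finite J"
      by (rule obtain_subset_with_card_n)
    obtain s where s: "plane_covered p cl s J"
      using plane_covered_parallel_class[OF J(3,2)] J(1) by blast
    have "p * n + p - 1 \<le> card (I - J)" using Suc.prems J p by (subst card_Diff_subset) auto
    then obtain f r where fr: "\<And>k. k < n \<Longrightarrow> plane_covered p cl r {i\<in>I - J. f i = k}"
      using Suc.IH[of "I - J"] Suc.prems by blast
    \<comment> \<open>The removed parallel class \<open>J\<close> becomes the cover of plane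
      \<open>n\<close>.\<close>
    define f' where "f' i = (if i \<in> J then n else f i)" for i
    define r' where "r' i = (if i \<in> J then s i else r i)" for i
    have "plane_covered p cl r' {i\<in>I. f' i = k}" if "k < Suc n" for k
    proof (cases "k = n")
      case True
      have "plane_covered p cl r' J" using s by (subst plane_covered_cong[of J r' s]) (auto simp: r'_def)
      then show ?thesis by (rule plane_covered_mono) (use J True in \<open>auto simp: f'_def\<close>)
    next
      case False
      then have "plane_covered p cl r {i\<in>I - J. f i = k}" using fr that by simp
      then have "plane_covered p cl r' {i\<in>I - J. f i = k}"
        by (subst plane_covered_cong[of _ r' r]) (auto simp: r'_def)
      then show ?thesis by (rule plane_covered_mono) (auto simp: f'_def)
    qed
    then show ?thesis by blast
  next
    case False
    then show ?thesis using planes_covered_few[OF p Suc.prems] by (auto simp: not_le)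
  qed
qed simp

section \<open>Roots of unity\<close>

lemma finite_card_roots_of_unity:
  fixes d :: nat
  assumes "d > 0"
  shows "finite {x::'k::field. x ^ d = 1}" "card {x::'k::field. x ^ d = 1} \<le> d"
proof -
  let ?q = "Polynomial.monom 1 d - 1 :: 'k poly"
  have roots: "{x::'k. x ^ d = 1} = {x. poly ?q x = 0}" by (simp add: poly_monom)
  have "Polynomial.coeff ?q d = 1" using assms by simp
  then have q: "?q \<noteq> 0" by (metis coeff_0 zero_neq_one)
  have "degree ?q \<le> d" by (rule degree_diff_le) (simp_all add: degree_monom_le)
  then show "finite {x::'k. x ^ d = 1}" "card {x::'k. x ^ d = 1} \<le> d"
    using poly_roots_finite[OF q] card_poly_roots_bound[OF q] unfolding roots by simp_all
qed

definition elements_of_order :: "nat \<Rightarrow> 'k::field set" where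
  "elements_of_order d = {x. \<forall>k. x ^ k = 1 \<longleftrightarrow> d dvd k}"

lemma elements_of_order_subset: "elements_of_order d \<subseteq> {x. x ^ d = 1}"
proof
  fix x :: 'a assume "x \<in> elements_of_order d"
  then have "x ^ d = 1 \<longleftrightarrow> d dvd d" unfolding elements_of_order_def by blast
  then show "x \<in> {x. x ^ d = 1}" by simp
qed

lemma power_inj_on_elements_of_order:
  assumes z: "z \<in> elements_of_order d"
  shows "inj_on (\<lambda>k. z ^ k) {0<..d}"
proof (cases "d = 0")
  case False
  have z1: "z ^ k = 1 \<longleftrightarrow> d dvd k" for k using z by (simp add: elements_of_order_def)
  then have "z \<noteq> 0" using False by (metis dvd_refl power_0_left zero_neq_one)
  have "k = l" if "k \<le> l" "k \<in> {0<..d}" "l \<in> {0<..d}" "z ^ k = z ^ l" for k l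
  proof -
    have "z ^ l = z ^ k * z ^ (l - k)" using that(1) by (simp flip: power_add)
    then have "z ^ (l - k) = 1" using that(4) \<open>z \<noteq> 0\<close> by simp
    then have "d dvd l - k" using z1 by simp
    moreover have "l - k < d" using that by auto
    ultimately have "l - k = 0" using nat_dvd_not_less by blast
    then show ?thesis using that(1) by simp
  qed
  then show ?thesis unfolding inj_on_def by (metis nat_le_linear)
qed simp

text \<open>The powers of one element of order \<open>d\<close> exhaust the roots of
  \<open>X ^ d - 1\<close>, and only exponents coprime to \<open>d\<close> can give order
  \<open>d\<close> again.\<close>

lemma card_elements_of_order_le:
  assumes d: "d > 0"
  shows "card (elements_of_order d :: 'k::field set) \<le> totient d"
proof (cases "elements_of_order d = ({} :: 'k set)")
  case False
  then obtain z :: 'k where z: "z \<in> elements_of_order d" by blast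
  have z1: "z ^ k = 1 \<longleftrightarrow> d dvd k" for k using z by (simp add: elements_of_order_def)
  have "(\<lambda>k. z ^ k) ` {0<..d} = {x. x ^ d = 1}"
  proof (rule card_seteq)
    show "(\<lambda>k. z ^ k) ` {0<..d} \<subseteq> {x. x ^ d = 1}" using z1 by (auto simp flip: power_mult)
    show "card {x::'k. x ^ d = 1} \<le> card ((\<lambda>k. z ^ k) ` {0<..d})"
      using finite_card_roots_of_unity(2)[OF d] card_image[OF power_inj_on_elements_of_order[OF z]] by simp
  qed (use finite_card_roots_of_unity(1)[OF d] in simp)
  then have img: "elements_of_order d \<subseteq> (\<lambda>k. z ^ k) ` {0<..d}"
    using elements_of_order_subset[of d] by simp
  have "elements_of_order d \<subseteq> (\<lambda>k. z ^ k) ` totatives d"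
  proof
    fix x :: 'k assume x: "x \<in> elements_of_order d"
    then obtain k where k: "x = z ^ k" "k \<in> {0<..d}" using img by blast
    \<comment> \<open>If \<open>gcd k d > 1\<close>, the smaller exponent \<open>d'\<close> would
      already give \<open>x ^ d' = 1\<close>.\<close>
    obtain k' d' where kd: "k = gcd k d * k'" "d = gcd k d * d'" by (meson dvdE gcd_dvd1 gcd_dvd2)
    have "k * d' = d * k'" using kd by (metis mult.assoc mult.commute)
    then have "x ^ d' = 1" using z1[of "k * d'"] k(1) by (simp flip: power_mult)
    then have "d dvd d'" using x by (simp add: elements_of_order_def)
    moreover have "d' > 0" using kd(2) d by (metis gr0I mult_0_right less_irrefl)
    ultimately have "gcd k d * d' \<le> d'" using kd(2) dvd_imp_le by metis
    then have "gcd k d \<le> 1" using \<open>d' > 0\<close> by simp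
    moreover have "gcd k d > 0" using d by simp
    ultimately have "gcd k d = 1" by linarith
    then have "coprime k d" by (simp only: coprime_iff_gcd_eq_1)
    then have "k \<in> totatives d" using k(2) by (simp add: in_totatives_iff)
    then show "x \<in> (\<lambda>k. z ^ k) ` totatives d" unfolding k(1) by (rule imageI)
  qed
  then have "card (elements_of_order d :: 'k set) \<le> card ((\<lambda>k. z ^ k) ` totatives d)"
    by (intro card_mono) auto
  also have "\<dots> \<le> totient d" unfolding totient_def by (rule card_image_le) simp
  finally show ?thesis .
qed simp

lemma exists_order_of_root_of_unity:
  fixes x :: "'k::field"
  assumes "x ^ N = 1" "N > 0"
  shows "\<exists>d. d dvd N \<and> x \<in> elements_of_order d"
proof -
  define d where "d = (LEAST d. d > 0 \<and> x ^ d = 1)"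
  have d: "d > 0" "x ^ d = 1" using LeastI[of "\<lambda>d. d > 0 \<and> x ^ d = 1" N] assms by (auto simp: d_def)
  have "x ^ k = 1 \<longleftrightarrow> d dvd k" for k
  proof
    assume k: "x ^ k = 1"
    have "x ^ k = x ^ (d * (k div d)) * x ^ (k mod d)" by (simp flip: power_add)
    then have "x ^ (k mod d) = 1" using k d(2) by (simp add: power_mult)
    moreover have "k mod d < d" using d by simp
    ultimately have "k mod d = 0"
      using not_less_Least[of "k mod d" "\<lambda>d. d > 0 \<and> x ^ d = 1"] by (auto simp: d_def)
    then show "d dvd k" by auto
  qed (use d(2) in \<open>auto simp: power_mult\<close>)
  then show ?thesis using assms(1) unfolding elements_of_order_def by blast
qed

text \<open>The totients of the divisors of \<open>N\<close> add up to \<open>N\<close>, so each bound in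
  \<open>card_elements_of_order_le\<close> is attained.\<close>

lemma exists_element_of_full_order:
  assumes N: "N > 0" and card: "card {x::'k::field. x ^ N = 1} = N"
  shows "elements_of_order N \<noteq> ({} :: 'k set)"
proof
  assume empty: "elements_of_order N = ({} :: 'k set)"
  have fin: "finite {d. d dvd N}" using N by simp
  have pos: "d > 0" if "d dvd N" for d using that N by (metis dvd_0_left_iff gr0I)
  have "{x::'k. x ^ N = 1} \<subseteq> (\<Union>d\<in>{d. d dvd N}. elements_of_order d)"
    using exists_order_of_root_of_unity[OF _ N] by blast
  moreover have "finite (elements_of_order d :: 'k set)" if "d dvd N" for d
    by (rule finite_subset[OF elements_of_order_subset finite_card_roots_of_unity(1)[OF pos[OF that]]])
  ultimately have "N \<le> card (\<Union>d\<in>{d. d dvd N}. elements_of_order d :: 'k set)"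
    using fin card by (metis (no_types, lifting) card_mono finite_UN mem_Collect_eq)
  also have "\<dots> \<le> (\<Sum>d | d dvd N. card (elements_of_order d :: 'k set))"
    by (rule card_UN_le[OF fin])
  also have "\<dots> < (\<Sum>d | d dvd N. totient d)"
  proof (rule sum_strict_mono_ex1[OF fin])
    show "\<forall>d\<in>{d. d dvd N}. card (elements_of_order d :: 'k set) \<le> totient d"
      using card_elements_of_order_le pos by blast
    show "\<exists>d\<in>{d. d dvd N}. card (elements_of_order d :: 'k set) < totient d"
      using empty N by (intro bexI[of _ N]) auto
  qed
  finally show False by (simp add: totient_divisor_sum)
qed

text \<open>If \<open>N\<close> vanished in the field, all \<open>N\<close> roots of \<open>X\<^sup>N - 1\<close> would be roots of \<open>\<Sum>j<N. X\<^sup>j\<close>.\<close>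

lemma of_nat_neq_0_if_roots_of_unity:
  assumes N: "N > 0" and card: "card {x::'k::field. x ^ N = 1} = N"
  shows "(of_nat N :: 'k) \<noteq> 0"
proof
  assume zero: "(of_nat N :: 'k) = 0"
  define q :: "'k poly" where "q = (\<Sum>j<N. Polynomial.monom 1 j)"
  have q: "poly q x = (\<Sum>j<N. x ^ j)" for x by (simp add: q_def poly_sum poly_monom)
  have "Polynomial.coeff q (N - 1) = 1"
    using N by (simp add: q_def coeff_sum)
  then have "q \<noteq> 0" by auto
  have "degree q \<le> N - 1" unfolding q_def
    by (rule degree_sum_le) (auto intro: order.trans[OF degree_monom_le])
  have "{x::'k. x ^ N = 1} \<subseteq> {x. poly q x = 0}"
  proof clarify
    fix x :: 'k assume x: "x ^ N = 1"
    show "poly q x = 0"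
    proof (cases "x = 1")
      case True
      then show ?thesis using zero by (simp add: q)
    next
      case False
      then show ?thesis using x geometric_sum[of x N] by (simp add: q)
    qed
  qed
  then have "N \<le> card {x. poly q x = 0}"
    using card card_mono[OF poly_roots_finite[OF \<open>q \<noteq> 0\<close>]] by metis
  also have "\<dots> \<le> N - 1"
    using card_poly_roots_bound[OF \<open>q \<noteq> 0\<close>] \<open>degree q \<le> N - 1\<close> by simp
  finally show False using N by simp
qed

section \<open>The group algebra\<close>

text \<open>The linear extension of \<chi> to the group algebra. As the group is finite, the sum can
  run over the whole type instead of the support.\<close>

definition eval_char :: "('g::finite \<Rightarrow> 'k::comm_ring_1) \<Rightarrow> ('g \<Rightarrow>\<^sub>0 'k) \<Rightarrow> 'k" where
  "eval_char \<chi> f = (\<Sum>g\<in>UNIV. Poly_Mapping.lookup f g * \<chi> g)"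

lemma eval_char_single: "eval_char \<chi> (Poly_Mapping.single g a) = a * \<chi> g"
proof -
  have "eval_char \<chi> (Poly_Mapping.single g a) = (\<Sum>h\<in>UNIV. if g = h then a * \<chi> h else 0)"
    unfolding eval_char_def lookup_single by (intro sum.cong) (simp_all add: when_def)
  then show ?thesis by simp
qed

lemma eval_char_diff: "eval_char \<chi> (f - h) = eval_char \<chi> f - eval_char \<chi> h"
  by (simp add: eval_char_def lookup_minus left_diff_distrib sum_subtractf)

lemma lookup_mult_finite:
  fixes f h :: "'g::{finite,ab_group_add} \<Rightarrow>\<^sub>0 'k::comm_ring_1"
  shows "Poly_Mapping.lookup (f * h) k = (\<Sum>l\<in>UNIV. \<Sum>q\<in>UNIV. if k = l + q then Poly_Mapping.lookup f l * Poly_Mapping.lookup h q else 0)"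
  unfolding lookup_mult Sum_any.expand_superset[OF finite subset_UNIV] sum_distrib_left
  by (intro sum.cong) (simp_all add: when_def)

lemma eval_char_mult:
  fixes \<chi> :: "'g::{finite,ab_group_add} \<Rightarrow> 'k::comm_ring_1"
  assumes "\<And>g h. \<chi> (g + h) = \<chi> g * \<chi> h"
  shows "eval_char \<chi> (f * h) = eval_char \<chi> f * eval_char \<chi> h"
proof -
  have "eval_char \<chi> (f * h) = (\<Sum>k\<in>UNIV. \<Sum>l\<in>UNIV. \<Sum>q\<in>UNIV. if k = l + q then Poly_Mapping.lookup f l * Poly_Mapping.lookup h q * \<chi> k else 0)"
    unfolding eval_char_def lookup_mult_finite sum_distrib_right by (intro sum.cong) auto
  also have "\<dots> = (\<Sum>l\<in>UNIV. \<Sum>q\<in>UNIV. \<Sum>k\<in>UNIV. if k = l + q then Poly_Mapping.lookup f l * Poly_Mapping.lookup h q * \<chi> k else 0)"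
    by (subst sum.swap, rule sum.cong[OF refl], rule sum.swap)
  also have "\<dots> = (\<Sum>l\<in>UNIV. \<Sum>q\<in>UNIV. (Poly_Mapping.lookup f l * \<chi> l) * (Poly_Mapping.lookup h q * \<chi> q))"
    by (simp add: assms mult_ac)
  also have "\<dots> = eval_char \<chi> f * eval_char \<chi> h"
    unfolding eval_char_def sum_product ..
  finally show ?thesis .
qed

text \<open>Over a field and for finite \<open>I\<close>, a character thus kills the product iff
  \<open>\<chi> (g i) = a i\<close> for some \<open>i\<close>, which is the covering
  condition.\<close>

lemma eval_char_prod_linear:
  fixes \<chi> :: "'g::{finite,ab_group_add} \<Rightarrow> 'k::comm_ring_1"
  assumes "\<And>g h. \<chi> (g + h) = \<chi> g * \<chi> h" and "\<chi> 0 = 1"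
  shows "eval_char \<chi> (\<Prod>i\<in>I. Poly_Mapping.single (g i) 1 - Poly_Mapping.single 0 (a i)) = (\<Prod>i\<in>I. \<chi> (g i) - a i)"
proof (induction I rule: infinite_finite_induct)
  case (insert i I)
  then show ?case by (simp add: eval_char_mult[OF assms(1)] eval_char_diff eval_char_single assms(2))
qed (use eval_char_single[of \<chi> 0 1] assms(2) in simp_all)

lemma prod_single:
  fixes g :: "'i \<Rightarrow> 'g::comm_monoid_add" and a :: "'i \<Rightarrow> 'k::comm_ring_1"
  shows "(\<Prod>i\<in>I. Poly_Mapping.single (g i) (a i)) = Poly_Mapping.single (\<Sum>i\<in>I. g i) (\<Prod>i\<in>I. a i)"
  by (induction I rule: infinite_finite_induct) (simp_all add: mult_single)

text \<open>For a zero-sum free sequence, only the empty subsequence contributes to the coefficient at \<open>0\<close>.\<close>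

lemma prod_linear_neq_0_if_zero_sum_free:
  fixes gs :: "'g::{finite,ab_group_add} list" and a :: "nat \<Rightarrow> 'k::idom"
  assumes gs: "zero_sum_free gs" and a: "\<And>i. i < length gs \<Longrightarrow> a i \<noteq> 0"
  shows "(\<Prod>i<length gs. Poly_Mapping.single (gs ! i) 1 - Poly_Mapping.single 0 (a i)) \<noteq> 0"
proof -
  let ?L = "{..<length gs}"
  have "(\<Prod>i\<in>?L. Poly_Mapping.single (gs ! i) 1 - Poly_Mapping.single 0 (a i))
    = (\<Prod>i\<in>?L. Poly_Mapping.single (gs ! i) 1 + Poly_Mapping.single 0 (- a i))"
    by (simp add: single_uminus)
  also have "\<dots> = (\<Sum>I\<in>Pow ?L. Poly_Mapping.single (\<Sum>i\<in>I. gs ! i) (\<Prod>i\<in>?L - I. - a i))"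
    by (subst prod_add) (simp_all add: prod_single mult_single)
  finally have eq: "(\<Prod>i\<in>?L. Poly_Mapping.single (gs ! i) 1 - Poly_Mapping.single 0 (a i)) = \<dots>" .
  have "Poly_Mapping.lookup (\<Prod>i\<in>?L. Poly_Mapping.single (gs ! i) 1 - Poly_Mapping.single 0 (a i)) 0
    = (\<Sum>I\<in>Pow ?L. if I = {} then (\<Prod>i\<in>?L. - a i) else 0)"
    unfolding eq lookup_sum lookup_single using gs
    by (intro sum.cong) (auto simp: zero_sum_free_def when_def)
  also have "\<dots> = (\<Prod>i\<in>?L. - a i)" by (simp add: sum.remove[of _ "{}"])
  also have "\<dots> \<noteq> 0" using a by simp
  finally show ?thesis by (metis lookup_zero)
qed

lemma zero_sum_free_length_le_davenport_over:
  fixes gs :: "'g::{finite,ab_group_add} list"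
  assumes "zero_sum_free gs"
  shows "enat (length gs) \<le> davenport_over TYPE('g) TYPE('k::idom)"
  unfolding davenport_over_def
  by (rule Sup_upper, rule CollectI, intro exI[of _ gs] conjI refl allI impI
      prod_linear_neq_0_if_zero_sum_free[OF assms]) simp

lemma small_davenport_attained:
  "\<exists>gs :: 'g::{finite,ab_group_add} list. zero_sum_free gs \<and> length gs = small_davenport TYPE('g)"
proof -
  have "small_davenport TYPE('g) \<in> {length gs | gs :: 'g list. zero_sum_free gs}"
    unfolding small_davenport_def using zero_sum_free_Nil
    by (intro Max_in finite_zero_sum_free_lengths) blast
  then show ?thesis by auto
qed

lemma power_eq_if_cong:
  assumes z: "z \<in> elements_of_order N" and "[a = b] (mod N)"
  shows "z ^ a = z ^ b"
proof -
  have z1: "z ^ (N * k) = 1" for k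
    using z by (simp add: elements_of_order_def)
  have "z ^ a = z ^ (N * (a div N)) * z ^ (a mod N)" for a by (simp flip: power_add)
  then have "z ^ a = z ^ (a mod N)" for a by (simp add: z1)
  then show ?thesis using assms(2) by (metis cong_def)
qed

lemma cong_if_power_eq:
  assumes z: "z \<in> elements_of_order N" "z \<noteq> 0" and eq: "z ^ a = z ^ b"
  shows "[a = b] (mod N)"
  using eq
proof (induction a b rule: linorder_wlog)
  case (le a b)
  have "z ^ b = z ^ a * z ^ (b - a)" using le(1) by (simp flip: power_add)
  then have "z ^ (b - a) = 1" using le(2) z(2) by simp
  then have "N dvd b - a" using z(1) by (simp add: elements_of_order_def)
  then have "[b = a] (mod N)" using le(1) by (simp add: cong_altdef_nat)
  then show ?case by (rule cong_sym)
next
  case (sym a b)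
  then show ?case using cong_sym by metis
qed

section \<open>Groups of rank two\<close>

text \<open>Coordinates are natural numbers, so that they can enter exponents of \<open>z\<close>
  and the divisibility lemmas on zero-sum subsets.\<close>

locale rank_two_coordinates =
  fixes p n :: nat and c d :: "'g::{finite,ab_group_add} \<Rightarrow> nat"
  assumes prime_p: "prime p" and n_pos: "n > 0"
    and c_add: "c (g + h) = (c g + c h) mod p"
    and d_add: "d (g + h) = (d g + d h) mod (p * n)"
    and bij: "bij_betw (\<lambda>g. (c g, d g)) UNIV ({..<p} \<times> {..<p * n})"
begin

lemma p_gt_1: "p > 1"
  using prime_gt_1_nat[OF prime_p] .

lemma pn_gt_1: "p * n > 1"
proof -
  have "p * 1 \<le> p * n" using n_pos by (intro mult_le_mono2) simp
  then show ?thesis using p_gt_1 by linarith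
qed

lemma c_less: "c g < p" and d_less: "d g < p * n"
  using bij_betw_apply[OF bij, of g] by auto

lemma exists_coordinates: "i < p \<Longrightarrow> j < p * n \<Longrightarrow> \<exists>g. c g = i \<and> d g = j"
proof -
  assume "i < p" "j < p * n"
  then have "(i, j) \<in> range (\<lambda>g. (c g, d g))" unfolding bij_betw_imp_surj_on[OF bij] by simp
  then show ?thesis by auto
qed

lemma c_0: "c 0 = 0" and d_0: "d 0 = 0"
proof -
  have "[c 0 + c 0 = c 0 + 0] (mod p)" using c_add[of 0 0] c_less[of 0] by (simp add: cong_def)
  then have "p dvd c 0" unfolding cong_add_lcancel_nat by (simp add: cong_0_iff)
  then show "c 0 = 0" using c_less[of 0] nat_dvd_not_less by blast
  have "[d 0 + d 0 = d 0 + 0] (mod p * n)" using d_add[of 0 0] d_less[of 0] by (simp add: cong_def)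
  then have "p * n dvd d 0" unfolding cong_add_lcancel_nat by (simp add: cong_0_iff)
  then show "d 0 = 0" using d_less[of 0] nat_dvd_not_less by blast
qed

lemma eq_0_iff: "g = 0 \<longleftrightarrow> p dvd c g \<and> p * n dvd d g"
proof
  assume "p dvd c g \<and> p * n dvd d g"
  then have "c g = 0" "d g = 0" using c_less[of g] d_less[of g] nat_dvd_not_less by blast+
  then have "(c g, d g) = (c 0, d 0)" by (simp add: c_0 d_0)
  then show "g = 0" using bij_betw_imp_inj_on[OF bij] by (simp add: inj_on_def)
qed (simp add: c_0 d_0)

lemma sum_eq_0_iff:
  "(\<Sum>i\<in>I. g i) = 0 \<longleftrightarrow> p dvd (\<Sum>i\<in>I. c (g i)) \<and> p * n dvd (\<Sum>i\<in>I. d (g i))"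
proof -
  have "c (\<Sum>i\<in>I. g i) mod p = (\<Sum>i\<in>I. c (g i)) mod p"
    by (induction I rule: infinite_finite_induct) (simp_all add: c_0 c_add, metis mod_add_right_eq)
  moreover have "d (\<Sum>i\<in>I. g i) mod (p * n) = (\<Sum>i\<in>I. d (g i)) mod (p * n)"
    by (induction I rule: infinite_finite_induct) (simp_all add: d_0 d_add, metis mod_add_right_eq)
  ultimately show ?thesis unfolding eq_0_iff by (simp add: dvd_eq_mod_eq_0)
qed

lemma group_exponent: "group_exponent TYPE('g) = p * n"
proof -
  have "(\<forall>g::'g. (\<Sum>i<m. g) = 0) \<longleftrightarrow> p * n dvd m" for m
  proof
    assume *: "\<forall>g::'g. (\<Sum>i<m. g) = 0"
    obtain g where "c g = 0" "d g = 1" using exists_coordinates[of 0 1] pn_gt_1 p_gt_1 by auto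
    then show "p * n dvd m" using *[rule_format, of g] by (simp add: sum_eq_0_iff)
  next
    assume "p * n dvd m"
    then show "\<forall>g::'g. (\<Sum>i<m. g) = 0"
      by (simp add: sum_eq_0_iff) (meson dvd_mult2 dvd_mult_left)
  qed
  then show ?thesis
    unfolding group_exponent_def using p_gt_1 n_pos
    by (intro Least_equality) (auto dest: dvd_imp_le)
qed

section \<open>The value of \<open>small_davenport\<close>\<close>

lemma small_davenport_le: "small_davenport TYPE('g) \<le> p * n + p - 2"
proof -
  obtain gs :: "'g list" where gs: "zero_sum_free gs" "length gs = small_davenport TYPE('g)"
    using small_davenport_attained by blast
  show ?thesis
  proof (rule ccontr)
    assume "\<not> ?thesis"
    then have "p * n + p - 1 \<le> card {..<length gs}" using gs by simp
    from exists_zero_sum_subset_rank_two[OF prime_p n_pos _ this, of "\<lambda>i. c (gs ! i)" "\<lambda>i. d (gs ! i)"]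
    obtain I where I: "I \<subseteq> {..<length gs}" "I \<noteq> {}"
      "p dvd (\<Sum>i\<in>I. c (gs ! i))" "p * n dvd (\<Sum>i\<in>I. d (gs ! i))" by auto
    then have "(\<Sum>i\<in>I. gs ! i) = 0" by (simp add: sum_eq_0_iff)
    then show False using gs(1) I(1,2) unfolding zero_sum_free_def by blast
  qed
qed

text \<open>The extremal sequence has \<open>p - 1\<close> and \<open>p * n - 1\<close> copies of
  two generators. The coordinates count the copies in a subsequence, and both counts stay below the
  orders.\<close>

lemma small_davenport_ge: "p * n + p - 2 \<le> small_davenport TYPE('g)"
proof -
  have "0 < p" "0 < p * n" using p_gt_1 pn_gt_1 by linarith+
  with exists_coordinates p_gt_1 pn_gt_1 obtain e1 e2
    where e1: "c e1 = 1" "d e1 = 0" and e2: "c e2 = 0" "d e2 = 1" by metis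
  define gs where "gs = replicate (p - 1) e1 @ replicate (p * n - 1) e2"
  have len: "length gs = (p - 1) + (p * n - 1)" by (simp add: gs_def)
  have "zero_sum_free gs"
    unfolding zero_sum_free_def
  proof (intro allI impI notI)
    fix I assume I: "I \<subseteq> {..<length gs}" "I \<noteq> {}" "(\<Sum>i\<in>I. gs ! i) = 0"
    have fin: "finite I" using I(1) finite_subset by blast
    have dvd: "k = 0" if "q dvd k" "k \<le> q - 1" "q > 1" for k q :: nat
      using dvd_imp_le[OF that(1)] that(2,3) by (cases k) auto
    have "(\<Sum>i\<in>I. c (gs ! i)) = (\<Sum>i\<in>I. if i \<in> {..<p - 1} then 1 else 0)"
      using I(1) e1 e2 by (intro sum.cong) (auto simp: gs_def nth_append)
    also have "\<dots> = card (I \<inter> {..<p - 1})" unfolding sum.inter_restrict[OF fin, symmetric] by simp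
    finally have "p dvd card (I \<inter> {..<p - 1})" using I(3) sum_eq_0_iff by metis
    moreover have "card (I \<inter> {..<p - 1}) \<le> card {..<p - 1}" by (intro card_mono) auto
    ultimately have "card (I \<inter> {..<p - 1}) = 0" using p_gt_1 by (intro dvd) simp_all
    then have 1: "I \<inter> {..<p - 1} = {}" by simp
    have "(\<Sum>i\<in>I. d (gs ! i)) = (\<Sum>i\<in>I. 1)"
      using I(1) 1 e2 by (intro sum.cong) (auto simp: gs_def nth_append)
    then have "p * n dvd card I" using I(3) unfolding sum_eq_0_iff by simp
    moreover have "I \<subseteq> {p - 1..<length gs}" using I(1) 1 by (fastforce simp: disjoint_iff not_less)
    then have "card I \<le> card {p - 1..<length gs}" by (intro card_mono) auto
    ultimately have "card I = 0" using pn_gt_1 by (intro dvd) (simp_all only: len card_atLeastLessThan add_diff_cancel_left')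
    then show False using fin I(2) by simp
  qed
  then have "length gs \<in> {length gs | gs :: 'g list. zero_sum_free gs}" by blast
  from Max_ge[OF finite_zero_sum_free_lengths this] show ?thesis
    using p_gt_1 pn_gt_1 unfolding small_davenport_def len by simp
qed

section \<open>Characters and Fourier inversion\<close>

text \<open>For \<open>x < p\<close> and \<open>y < p * n\<close> these are all the characters when
  \<open>z\<close> has order \<open>p * n\<close>; then \<open>z ^ n\<close> has order
  \<open>p\<close>, whence the factor \<open>n\<close>.\<close>

definition chi :: "'k::field \<Rightarrow> nat \<Rightarrow> nat \<Rightarrow> 'g \<Rightarrow> 'k" where
  "chi z x y g = z ^ (n * x * c g + y * d g)"

context
  fixes z :: "'k::field"
  assumes z: "z \<in> elements_of_order (p * n)"
begin

lemma power_eq_1_iff: "z ^ k = 1 \<longleftrightarrow> p * n dvd k"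
  using z by (simp add: elements_of_order_def)

lemma z_neq_0: "z \<noteq> 0"
proof
  assume "z = 0"
  moreover have "p * n \<noteq> 0" using pn_gt_1 by linarith
  ultimately have "z ^ (p * n) = 0" by (simp only: power_0_left if_False)
  moreover have "z ^ (p * n) = 1" unfolding power_eq_1_iff by simp
  ultimately show False by simp
qed

lemma cong_n_mult: "[a = b] (mod p) \<Longrightarrow> [n * a = n * b] (mod p * n)"
  by (simp only: cong_def mult.commute[of p n] mult_mod_right[symmetric])

lemma chi_add: "chi z x y (g + h) = chi z x y g * chi z x y h"
proof -
  have "[n * (x * c (g + h)) = n * (x * (c g + c h))] (mod p * n)"
    unfolding c_add by (intro cong_n_mult cong_scalar_left) (simp add: cong_def)
  moreover have "[y * d (g + h) = y * (d g + d h)] (mod p * n)"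
    unfolding d_add by (intro cong_scalar_left) (simp add: cong_def)
  ultimately have "[n * x * c (g + h) + y * d (g + h) = n * x * (c g + c h) + y * (d g + d h)] (mod p * n)"
    unfolding mult.assoc by (rule cong_add)
  from power_eq_if_cong[OF z this] show ?thesis
    by (simp add: chi_def algebra_simps flip: power_add)
qed

lemma chi_0: "chi z x y 0 = 1"
  by (simp add: chi_def c_0 d_0)

text \<open>Orthogonality: the sum factors into two geometric sums, one of which vanishes if
  \<open>g\<close> is nonzero.\<close>

lemma sum_chi: "(\<Sum>x<p. \<Sum>y<p * n. chi z x y g) = (if g = 0 then of_nat (p * (p * n)) else 0)"
proof -
  have "(\<Sum>x<p. \<Sum>y<p * n. chi z x y g) = (\<Sum>x<p. (z ^ (n * c g)) ^ x) * (\<Sum>y<p * n. (z ^ d g) ^ y)"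
    unfolding sum_product by (simp add: chi_def power_add mult_ac flip: power_mult)
  also have "\<dots> = (if g = 0 then of_nat (p * (p * n)) else 0)"
  proof (cases "g = 0")
    case True
    then show ?thesis by (simp add: c_0 d_0)
  next
    case False
    then consider "\<not> p dvd c g" | "\<not> p * n dvd d g" using eq_0_iff by blast
    then show ?thesis
    proof cases
      case 1
      then have "z ^ (n * c g) \<noteq> 1" using n_pos by (simp add: power_eq_1_iff mult.commute)
      moreover have "(z ^ (n * c g)) ^ p = 1"
        by (simp add: power_eq_1_iff mult_ac flip: power_mult)
      ultimately show ?thesis using False by (simp add: geometric_sum)
    next
      case 2
      then have "z ^ d g \<noteq> 1" by (simp add: power_eq_1_iff)
      moreover have "(z ^ d g) ^ (p * n) = 1" unfolding power_mult[symmetric] by (simp add: power_eq_1_iff)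
      ultimately show ?thesis using False by (simp add: geometric_sum)
    qed
  qed
  finally show ?thesis .
qed

text \<open>Fourier inversion recovers each coefficient up to the factor \<open>p * (p * n)\<close>,
  which is nonzero by \<open>N\<close>.\<close>

lemma eq_0_if_eval_char_eq_0:
  assumes N: "(of_nat (p * n) :: 'k) \<noteq> 0"
    and eval: "\<And>x y. x < p \<Longrightarrow> y < p * n \<Longrightarrow> eval_char (chi z x y) f = 0"
  shows "f = 0"
proof (rule poly_mapping_eqI)
  fix g
  have "0 = (\<Sum>x<p. \<Sum>y<p * n. chi z x y (- g) * eval_char (chi z x y) f)" using eval by simp
  also have "\<dots> = (\<Sum>x<p. \<Sum>y<p * n. \<Sum>h\<in>UNIV. Poly_Mapping.lookup f h * chi z x y (h - g))"
    unfolding eval_char_def sum_distrib_left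
    by (intro sum.cong refl) (simp add: chi_add[of _ _ _ "- g", simplified] mult_ac)
  also have "\<dots> = (\<Sum>x<p. \<Sum>h\<in>UNIV. \<Sum>y<p * n. Poly_Mapping.lookup f h * chi z x y (h - g))"
    by (intro sum.cong refl sum.swap)
  also have "\<dots> = (\<Sum>h\<in>UNIV. Poly_Mapping.lookup f h * (\<Sum>x<p. \<Sum>y<p * n. chi z x y (h - g)))"
    by (subst sum.swap) (simp add: sum_distrib_left)
  also have "\<dots> = (\<Sum>h\<in>UNIV. if g = h then Poly_Mapping.lookup f h * of_nat (p * (p * n)) else 0)"
    unfolding sum_chi by (intro sum.cong) auto
  also have "\<dots> = Poly_Mapping.lookup f g * of_nat (p * (p * n))" by simp
  finally show "Poly_Mapping.lookup f g = Poly_Mapping.lookup 0 g" using N by auto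
qed

section \<open>From covers of planes to bounds for \<open>davenport_over\<close>\<close>

lemma davenport_over_le:
  assumes p: "p = 2 \<or> p = 3" and N: "(of_nat (p * n) :: 'k) \<noteq> 0"
  shows "davenport_over TYPE('g) TYPE('k) \<le> enat (p * n + p - 2)"
  unfolding davenport_over_def
proof (rule Sup_least, safe)
  fix gs :: "'g list"
  assume no: "\<forall>a::nat \<Rightarrow> 'k. (\<forall>i<length gs. a i \<noteq> 0) \<longrightarrow>
    (\<Prod>i<length gs. Poly_Mapping.single (gs ! i) 1 - Poly_Mapping.single 0 (a i)) \<noteq> 0"
  show "enat (length gs) \<le> enat (p * n + p - 2)"
  proof (rule ccontr)
    assume "\<not> ?thesis"
    then have len: "p * n + p - 1 \<le> card {..<length gs}" by simp
    \<comment> \<open>The direction of \<open>g\<close> is the slope \<open>c g / d g\<close> modulo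
      \<open>p\<close>, or vertical if \<open>p\<close> divides \<open>d g\<close>.\<close>
    have "\<exists>j\<le>p. if j < p then \<not> p dvd d g \<and> [c g = d g * j] (mod p) else p dvd d g" for g
    proof (cases "p dvd d g")
      case False
      from prime_imp_coprime[OF prime_p this] have "coprime (d g) p"
        by (rule coprime_commute[THEN iffD1])
      from cong_solve_coprime_nat[OF this] obtain u where "[d g * u = 1] (mod p)" by auto
      then have "[d g * u * c g = 1 * c g] (mod p)" by (rule cong_scalar_right)
      then have "[c g = d g * (u * c g mod p)] (mod p)" by (simp add: cong_def mod_simps mult_ac)
      then show ?thesis using False p_gt_1
        by (intro exI[of _ "u * c g mod p"]) (auto intro: less_imp_le)
    qed auto
    then obtain dir where dir: "\<And>g. dir g \<le> p"
      "\<And>g. if dir g < p then \<not> p dvd d g \<and> [c g = d g * dir g] (mod p) else p dvd d g" by metis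
    obtain f r where fr: "\<And>k. k < n \<Longrightarrow>
        plane_covered p (\<lambda>i. dir (gs ! i)) r {i\<in>{..<length gs}. f i = k}"
      using exists_planes_covered[OF p _ len, of "\<lambda>i. dir (gs ! i)"] dir(1) by blast
    \<comment> \<open>The value that characters take on \<open>g\<close> along the line with
      constant \<open>r i\<close> in plane \<open>f i\<close>.\<close>
    define a where "a i = (let g = gs ! i in z ^ (f i * d g + n * ((if dir g < p then d g else c g) * r i)))" for i
    have "eval_char (chi z x y) (\<Prod>i<length gs. Poly_Mapping.single (gs ! i) 1 - Poly_Mapping.single 0 (a i)) = 0"
      if xy: "x < p" "y < p * n" for x y
    proof -
      \<comment> \<open>Here \<open>y mod n\<close> selects the plane, and \<open>y div n\<close> is
        the second coordinate in it.\<close>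
      have "y mod n < n" "y div n < p"
        using n_pos xy(2) by (auto simp: less_mult_imp_div_less)
      with fr[of "y mod n"] xy(1) obtain i where i: "i < length gs" "f i = y mod n"
        "line_form p (dir (gs ! i)) x (y div n) = r i"
        unfolding plane_covered_def by blast
      define g where "g = gs ! i"
      have "[x * c g + (y div n) * d g = (if dir g < p then d g else c g) * r i] (mod p)"
      proof (cases "dir g < p")
        case True
        then have "[x * c g = x * (d g * dir g)] (mod p)" using dir(2)[of g] by (simp add: cong_scalar_left)
        then have "[x * c g + (y div n) * d g = x * (d g * dir g) + (y div n) * d g] (mod p)"
          by (rule cong_add) simp
        also have "x * (d g * dir g) + (y div n) * d g = d g * (dir g * x + y div n)"
          by (simp add: algebra_simps)
        also have "[d g * (dir g * x + y div n) = d g * r i] (mod p)"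
          using i(3)[symmetric] True by (intro cong_scalar_left) (simp add: line_form_def cong_def g_def)
        finally show ?thesis using True by simp
      next
        case False
        then have "p dvd d g" using dir(2)[of g] by simp
        then have "[x * c g + (y div n) * d g = x * c g + 0] (mod p)"
          by (intro cong_add) (auto simp: cong_0_iff)
        also have "[x * c g + 0 = c g * r i] (mod p)"
          unfolding add_0_right mult.commute[of x]
          using i(3)[symmetric] False by (intro cong_scalar_left) (simp add: line_form_def cong_def g_def)
        finally show ?thesis using False by simp
      qed
      from cong_n_mult[OF this]
      have "[(y mod n) * d g + n * (x * c g + (y div n) * d g) =
          f i * d g + n * ((if dir g < p then d g else c g) * r i)] (mod p * n)"
        unfolding i(2) by (intro cong_add cong_refl)
      moreover have "n * x * c g + y * d g = (y mod n) * d g + n * (x * c g + (y div n) * d g)"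
        using mod_mult_div_eq[of y n] by (metis (no_types, lifting) add.commute add.left_commute add_mult_distrib add_mult_distrib2 mult.assoc)
      ultimately have "chi z x y g = a i"
        unfolding chi_def a_def Let_def g_def[symmetric] by (metis power_eq_if_cong[OF z])
      then have "(\<Prod>i<length gs. chi z x y (gs ! i) - a i) = 0"
        using i(1) unfolding g_def by (intro prod_zero) auto
      then show ?thesis by (subst eval_char_prod_linear) (simp_all add: chi_add chi_0)
    qed
    from eq_0_if_eval_char_eq_0[OF N this] no show False
      using z_neq_0 by (auto simp: a_def Let_def)
  qed
qed

lemma davenport_over_ge:
  assumes p: "p \<ge> 5" and n: "n \<ge> 2"
  shows "enat (p * n + p - 1) \<le> davenport_over TYPE('g) TYPE('k)"
proof -
  have "\<exists>g. c g = j \<and> d g = 1" if "j < 5" for j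
    using exists_coordinates[of j 1] that p pn_gt_1 by simp
  then obtain e where e: "\<And>j. j < 5 \<Longrightarrow> c (e j) = j \<and> d (e j) = 1" by metis
  \<comment> \<open>The multiplicities of \<open>exists_uncovered_point\<close>, with total
    \<open>p * n + p - 1\<close>; the terms are elements with coordinates
    \<open>(j, 1)\<close>.\<close>
  define js :: "nat list" where
    "js = replicate ((n - 1) * p - 1) 0 @ replicate (p - 1) 1 @ replicate (p - 1) 2 @ replicate 2 3"
  define gs where "gs = map e js"
  have "(n - 1) * p + p = n * p" "(n - 1) * p > 0" using n p by (cases n; simp)+
  then have len: "length gs = p * n + p - 1"
    using p unfolding gs_def js_def by (simp add: mult.commute)
  have js4: "js ! i < 5" if "i < length gs" for i
  proof -
    have "js ! i \<in> set js" using that by (simp add: gs_def)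
    then show ?thesis by (auto simp: js_def)
  qed
  have cnt: "card {i\<in>{..<length gs}. js ! i = j} = count_list js j" for j
    by (simp add: gs_def count_list_eq_length_filter length_filter_conv_card eq_commute[of j])
  have "count_list (replicate k x) y = (if x = y then k else 0)" for k and x y :: nat
    by (induction k) auto
  then have counts: "count_list js 0 = (n - 1) * p - 1" "count_list js 1 = p - 1"
    "count_list js 2 = p - 1" "count_list js 3 = 2"
    by (simp_all only: js_def count_list_append) simp_all
  have "(\<Prod>i<length gs. Poly_Mapping.single (gs ! i) 1 - Poly_Mapping.single 0 (a i)) \<noteq> 0" for a :: "nat \<Rightarrow> 'k"
  proof
    assume "(\<Prod>i<length gs. Poly_Mapping.single (gs ! i) 1 - Poly_Mapping.single 0 (a i)) = 0"
    then have "(\<Prod>i<length gs. chi z x y (gs ! i) - a i) = 0" for x y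
      using eval_char_prod_linear[of "chi z x y" "\<lambda>i. gs ! i" a "{..<length gs}"]
      by (simp add: chi_add chi_0 eval_char_def)
    then have cover: "\<exists>i<length gs. chi z x y (gs ! i) = a i" for x y by (auto simp: Bex_def)
    \<comment> \<open>If \<open>a i\<close> is no power of \<open>z\<close>, then \<open>s i\<close>
      is arbitrary. This does no harm, since no character takes the value
      \<open>a i\<close>.\<close>
    define s where "s i = (SOME k. z ^ k = a i)" for i
    have s: "z ^ s i = a i" if "z ^ k = a i" for k i
      unfolding s_def using that by (rule someI)
    \<comment> \<open>Term \<open>i\<close> is read as a line in plane \<open>s i mod n\<close> with
      constant \<open>s i div n\<close>.\<close>
    obtain k x y where kxy: "k < n" "\<And>i. i < length gs \<Longrightarrow> js ! i \<le> 3 \<Longrightarrow> s i mod n = k \<Longrightarrow>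
        (int (js ! i) * x + y) mod int p \<noteq> int (s i div n) mod int p"
      using exists_uncovered_point[OF prime_p p n, of "{..<length gs}" "\<lambda>i. js ! i" "\<lambda>i. s i mod n" "\<lambda>i. int (s i div n)"]
      unfolding cnt counts by blast
    define x' y' where "x' = nat (x mod int p)" and "y' = nat (y mod int p)"
    have x'y': "int x' = x mod int p" "int y' = y mod int p" using p by (simp_all add: x'_def y'_def)
    obtain i where i: "i < length gs" "chi z x' (k + n * y') (gs ! i) = a i" using cover by blast
    then have cd: "c (gs ! i) = js ! i" "d (gs ! i) = 1" using e js4 by (simp_all add: gs_def)
    have "z ^ (k + n * (js ! i * x' + y')) = a i"
      using i(2) unfolding chi_def cd by (simp add: algebra_simps)
    then have eq: "z ^ s i = z ^ (k + n * (js ! i * x' + y'))" using s by metis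
    have "[s i = k + n * (js ! i * x' + y')] (mod p * n)"
      by (rule cong_if_power_eq[OF z z_neq_0 eq])
    \<comment> \<open>This form of the congruence avoids subtraction; division by \<open>n\<close>
      then separates plane and line.\<close>
    then obtain u v where "s i + u * (p * n) = k + n * (js ! i * x' + y') + v * (p * n)"
      by (metis cong_iff_lin_nat mult.commute)
    then have lin: "s i + n * (u * p) = k + n * (js ! i * x' + y' + v * p)" by (simp add: algebra_simps)
    then have "(s i + n * (u * p)) mod n = k" "(s i + n * (u * p)) div n = js ! i * x' + y' + v * p"
      using kxy(1) by simp_all
    then have mod: "s i mod n = k" and div: "s i div n + u * p = js ! i * x' + y' + v * p"
      using n by simp_all
    have "js ! i \<le> 3"
      using nth_mem[of i js] i(1) unfolding gs_def by (auto simp: js_def)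
    moreover have "(int (js ! i) * x + y) mod int p = int (s i div n) mod int p"
    proof -
      have "int (s i div n) mod int p = int ((s i div n + u * p) mod p)" by (simp add: zmod_int)
      also have "\<dots> = int ((js ! i * x' + y') mod p)" unfolding div by simp
      also have "\<dots> = (int (js ! i) * x + y) mod int p" 
        by (simp add: zmod_int x'y' mod_simps) (metis mod_add_left_eq mod_mult_right_eq)
      finally show ?thesis ..
    qed
    ultimately show False using kxy(2)[OF i(1)] mod by blast
  qed
  then have "enat (length gs) \<le> davenport_over TYPE('g) TYPE('k)"
    unfolding davenport_over_def by (intro Sup_upper CollectI exI[of _ gs] conjI refl allI impI)
  then show ?thesis unfolding len .
qed

end

end

section \<open>From the isomorphism to coordinates, and the theorem\<close>

lemma exists_rank_two_coordinates:
  assumes "prime p" "n > 0"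
    and iso: "additive_group TYPE('g::{finite,ab_group_add}) \<cong> integer_mod_group p \<times>\<times> integer_mod_group (p * n)"
  shows "\<exists>c d :: 'g \<Rightarrow> nat. rank_two_coordinates p n c d"
proof -
  obtain \<phi> where \<phi>: "\<phi> \<in> iso (additive_group TYPE('g)) (integer_mod_group p \<times>\<times> integer_mod_group (p * n))"
    using iso unfolding is_iso_def by blast
  have pos: "p > 0" "p * n > 0" using assms prime_gt_0_nat by auto
  have carrier: "carrier (integer_mod_group p \<times>\<times> integer_mod_group (p * n)) = {0..<int p} \<times> {0..<int (p * n)}"
    using pos by (simp add: carrier_integer_mod_group)
  have bij: "bij_betw \<phi> UNIV ({0..<int p} \<times> {0..<int (p * n)})"
    using \<phi> unfolding iso_def carrier by (simp add: additive_group_def)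
  have hom: "\<phi> (g + h) = ((fst (\<phi> g) + fst (\<phi> h)) mod int p, (snd (\<phi> g) + snd (\<phi> h)) mod int (p * n))" for g h
    using \<phi> unfolding iso_def hom_def by (simp add: additive_group_def mult_DirProd')
  have rng: "fst (\<phi> g) \<in> {0..<int p}" "snd (\<phi> g) \<in> {0..<int (p * n)}" for g
    using bij_betw_apply[OF bij, of g] by (auto simp: mem_Times_iff)
  have "bij_betw (map_prod nat nat) ({0..<int p} \<times> {0..<int (p * n)}) ({..<p} \<times> {..<p * n})"
    by (rule bij_betw_byWitness[where f' = "map_prod int int"])
      (auto simp: nat_less_iff simp del: of_nat_mult)
  from bij_betw_trans[OF bij this]
  have "bij_betw (\<lambda>g. (nat (fst (\<phi> g)), nat (snd (\<phi> g)))) UNIV ({..<p} \<times> {..<p * n})"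
    by (simp add: comp_def map_prod_def split_def)
  then have "rank_two_coordinates p n (\<lambda>g. nat (fst (\<phi> g))) (\<lambda>g. nat (snd (\<phi> g)))"
    using assms(1,2) rng by unfold_locales (simp_all add: hom nat_mod_distrib nat_add_distrib nat_mult_distrib)
  then show ?thesis by blast
qed

theorem theorem1p1:
  fixes p n :: nat
  assumes "prime p" and "n > 0"
    and "additive_group TYPE('g::{finite,ab_group_add}) \<cong>
           integer_mod_group p \<times>\<times> integer_mod_group (p * n)"
    and "splitting_field TYPE('g) TYPE('k::field)"
  shows "(p \<le> 3 \<longrightarrow> enat (small_davenport TYPE('g)) = davenport_over TYPE('g) TYPE('k)) \<and>
         (p \<ge> 5 \<and> n \<ge> 2 \<longrightarrow> enat (small_davenport TYPE('g)) < davenport_over TYPE('g) TYPE('k))"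
proof -
  obtain c d :: "'g \<Rightarrow> nat" where "rank_two_coordinates p n c d"
    using exists_rank_two_coordinates[OF assms(1-3)] by blast
  then interpret rank_two_coordinates p n c d .
  \<comment> \<open>This count yields both a primitive root of unity and that \<open>p * n\<close>
    is nonzero in the field.\<close>
  have card: "card {x::'k. x ^ (p * n) = 1} = p * n"
    using assms(4) unfolding splitting_field_def group_exponent .
  have pn: "p * n > 0" using pn_gt_1 by linarith
  obtain z :: 'k where z: "z \<in> elements_of_order (p * n)"
    using exists_element_of_full_order[OF pn card] by blast
  have small: "small_davenport TYPE('g) = p * n + p - 2"
    using small_davenport_le small_davenport_ge by (rule antisym)
  show ?thesis
  proof (intro conjI impI)
    assume "p \<le> 3"
    then have "p = 2 \<or> p = 3" using p_gt_1 by linarith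
    from davenport_over_le[OF z this of_nat_neq_0_if_roots_of_unity[OF pn card]]
    have "davenport_over TYPE('g) TYPE('k) \<le> enat (small_davenport TYPE('g))" by (simp add: small)
    moreover have "enat (small_davenport TYPE('g)) \<le> davenport_over TYPE('g) TYPE('k)"
      using small_davenport_attained zero_sum_free_length_le_davenport_over by metis
    ultimately show "enat (small_davenport TYPE('g)) = davenport_over TYPE('g) TYPE('k)" by simp
  next
    assume "p \<ge> 5 \<and> n \<ge> 2"
    then have "enat (p * n + p - 1) \<le> davenport_over TYPE('g) TYPE('k)"
      using davenport_over_ge[OF z] by blast
    moreover have "small_davenport TYPE('g) < p * n + p - 1" using small p_gt_1 by simp
    ultimately show "enat (small_davenport TYPE('g)) < davenport_over TYPE('g) TYPE('k)"
      by (meson enat_ord_simps(2) less_le_trans)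
  qed
qed

end
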